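(* Let $a>b>c>0$ and let $\mathcal{E}:\ \frac{x^2}{a^2}+\frac{y^2}{b^2}+\frac{z^2}{c^2}=1$. Then: (1) If $a^2<2c^2$, neither sheet of the caustic of $\mathcal{E}$ intersects $\mathcal{E}$. (2) If $b^2<2c^2\le a^2$, exactly one of the two sheets of the caustic intersects $\mathcal{E}$. (3) If $b^2\ge 2c^2$, both sheets of the caustic intersect $\mathcal{E}$. In all cases, for points $A\in\mathcal{E}$: $n(A)=2$ if $A$ lies outside both sheets, $n(A)=4$ if $A$ lies inside exactly one sheet, $n(A)=6$ if $A$ lies inside both sheets, and $n(A)\in\{3,5\}$ if $A$ lies on a sheet, except possibly for some points of $\mathcal{E}$ where the sheets intersect each other or where the sheets meet the coordinate planes.
   Context: For a point $A\in\mathbb{R}^3$, $n(A)$ is the number of points $B\in\mathcal{E}$ such that $A$ lies on the normal line to $\mathcal{E}$ at $B$ (for $A\in\mathcal{E}$, $B=A$ is counted). The caustic of $\mathcal{E}$ has two sheets: for each point $P\in\mathcal{E}$ with outer normal $\mathbf N=(x/a^2,y/b^2,z/c^2)$ and principal curvatures $k_1\le k_2$ (radii $R_i=1/k_i$), the centers of principal curvature are $C_i=P-R_i\mathbf N/|\mathbf N|$; the set of all $C_1$ and the set of all $C_2$ are the two sheets, each a closed surface bounding a region of space ("inside" the sheet). Equivalently the caustic is the set of $(X,Y,Z)$ for which some $t$ satisfies $\frac{a^2X^2}{(a^2+t)^2}+\frac{b^2Y^2}{(b^2+t)^2}+\frac{c^2Z^2}{(c^2+t)^2}=1$ and $\frac{a^2X^2}{(a^2+t)^3}+\frac{b^2Y^2}{(b^2+t)^3}+\frac{c^2Z^2}{(c^2+t)^3}=0$.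 *)

theory Defs
  imports "HOL-Analysis.Analysis"
begin

definition ell :: "real \<Rightarrow> real \<Rightarrow> real \<Rightarrow> (real^3) set" where
  "ell a b c = {p. (p$1)^2/a^2 + (p$2)^2/b^2 + (p$3)^2/c^2 = 1}"

definition ell_normal :: "real \<Rightarrow> real \<Rightarrow> real \<Rightarrow> real^3 \<Rightarrow> real^3" where
  "ell_normal a b c p = vector [p$1/a^2, p$2/b^2, p$3/c^2]"

text \<open>Second fundamental form of the level surface F = 1, F = x^2/a^2+y^2/b^2+z^2/c^2,
  w.r.t. the outer unit normal: II(v,v) = Hess F(v,v) / |grad F| = (v.Dv)/|N|.\<close>
definition ell_II :: "real \<Rightarrow> real \<Rightarrow> real \<Rightarrow> real^3 \<Rightarrow> real^3 \<Rightarrow> real" where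
  "ell_II a b c p v = ((v$1)^2/a^2 + (v$2)^2/b^2 + (v$3)^2/c^2) / norm (ell_normal a b c p)"

definition normal_curvatures :: "real \<Rightarrow> real \<Rightarrow> real \<Rightarrow> real^3 \<Rightarrow> real set" where
  "normal_curvatures a b c p =
     {ell_II a b c p v | v. v \<bullet> ell_normal a b c p = 0 \<and> norm v = 1}"

definition k1 :: "real \<Rightarrow> real \<Rightarrow> real \<Rightarrow> real^3 \<Rightarrow> real" where
  "k1 a b c p = Inf (normal_curvatures a b c p)"

definition k2 :: "real \<Rightarrow> real \<Rightarrow> real \<Rightarrow> real^3 \<Rightarrow> real" where
  "k2 a b c p = Sup (normal_curvatures a b c p)"

definition centre1 :: "real \<Rightarrow> real \<Rightarrow> real \<Rightarrow> real^3 \<Rightarrow> real^3" where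
  "centre1 a b c p = p - (1 / k1 a b c p) *\<^sub>R (ell_normal a b c p /\<^sub>R norm (ell_normal a b c p))"

definition centre2 :: "real \<Rightarrow> real \<Rightarrow> real \<Rightarrow> real^3 \<Rightarrow> real^3" where
  "centre2 a b c p = p - (1 / k2 a b c p) *\<^sub>R (ell_normal a b c p /\<^sub>R norm (ell_normal a b c p))"

definition sheet1 :: "real \<Rightarrow> real \<Rightarrow> real \<Rightarrow> (real^3) set" where
  "sheet1 a b c = centre1 a b c ` ell a b c"

definition sheet2 :: "real \<Rightarrow> real \<Rightarrow> real \<Rightarrow> (real^3) set" where
  "sheet2 a b c = centre2 a b c ` ell a b c"

definition nnormals :: "real \<Rightarrow> real \<Rightarrow> real \<Rightarrow> real^3 \<Rightarrow> nat" where
  "nnormals a b c A = card {B \<in> ell a b c. \<exists>t::real. A = B + t *\<^sub>R ell_normal a b c B}"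

definition coord_planes :: "(real^3) set" where
  "coord_planes = {x. x$1 = 0 \<or> x$2 = 0 \<or> x$3 = 0}"

definition exceptional :: "real \<Rightarrow> real \<Rightarrow> real \<Rightarrow> (real^3) set" where
  "exceptional a b c = ell a b c \<inter>
     ((sheet1 a b c \<inter> sheet2 a b c) \<union> ((sheet1 a b c \<union> sheet2 a b c) \<inter> coord_planes))"

end

theory Submission
  imports Defs
begin

text \<open>
  Write \<open>al = (a\<^sup>2, b\<^sup>2, c\<^sup>2)\<close>. A point B of the ellipsoid is the foot of a normal through A iff
  \<open>A$i = B$i * (1 + t / al i)\<close> for some t, so for A off the coordinate planes the feet correspond to
  the roots of \<open>F\<^sub>A(t) = 1\<close>, where \<open>F\<^sub>A(t) = (\<Sum>i. al i * (A$i)\<^sup>2 / (al i + t)\<^sup>2)\<close>. This function is strictly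
  convex between its poles and monotone outside them: there is one root on each side of all the
  poles, and each of the two bounded gaps carries 2, 1 or 0 roots according to whether the infimum
  of \<open>F\<^sub>A\<close> on the gap is below, equal to or above 1. If \<open>A$j = 0\<close>, the pole at \<open>- al j\<close> disappears
  and is replaced by a pair of feet symmetric in the j-th coordinate.

  A principal centre of curvature is the point on the normal at P with \<open>-1/t\<close> an extremal value of
  the quadratic form \<open>(\<Sum>i. (v$i)\<^sup>2 / al i)\<close> on unit tangent vectors; this makes t the minimiser of \<open>F\<^sub>A\<close>
  on the corresponding gap. Hence each sheet is the set where the infimum of \<open>F\<^sub>A\<close> over a gap
  equals 1. The infimum is homogeneous of degree 2 in A, so the sheet is the boundary of a compact
  region star-shaped about 0, which identifies its inside and outside.

  A sheet meets the ellipsoid iff the vertex \<open>(0, 0, c)\<close> is not strictly outside it, by connectedness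
  of the arc to \<open>(a, 0, 0)\<close>, which is always outside; otherwise \<open>\<bar>1 + t / al i\<bar> < 1\<close> for
  all i and the centre lies strictly inside the ellipsoid.
\<close>

section \<open>Star-shaped regions and indefinite forms\<close>

text \<open>As \<open>U\<close> is open and \<open>K\<close> closed, \<open>U\<close> and
  \<open>- K\<close> separate the complement of \<open>K - U\<close>, so the component of a point of
  \<open>U\<close> stays in the bounded set \<open>U\<close>. A point off \<open>K\<close> escapes
  to infinity along its ray, which cannot re-enter \<open>K\<close> because \<open>K\<close> is
  star-shaped about 0.\<close>

lemma inside_outside_starlike_diff:
  fixes K U :: "'a::{real_normed_vector} set"
  assumes "bounded K" "closed K" "open U" "U \<subseteq> K" "K \<noteq> {}"
    and star: "\<And>x c. x \<in> K \<Longrightarrow> 0 \<le> c \<Longrightarrow> c \<le> 1 \<Longrightarrow> c *\<^sub>R x \<in> K"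
  shows "inside (K - U) = U" and "outside (K - U) = - K"
proof -
  have zero: "0 \<in> K" using assms(5) star[of _ 0] by auto
  have U: "U \<subseteq> inside (K - U)"
  proof
    fix x assume x: "x \<in> U"
    let ?C = "connected_component_set (- (K - U)) x"
    have "connected ?C" by simp
    moreover have "?C \<subseteq> U \<union> - K" using connected_component_subset[of "-(K-U)" x] by blast
    moreover have "x \<in> U \<inter> ?C" using x connected_component_refl[of x "-(K-U)"] by auto
    moreover have "U \<inter> - K \<inter> ?C = {}" using assms(4) by blast
    ultimately have "- K \<inter> ?C = {}"
      using connectedD[of ?C U "- K"] assms(2-3) by blast
    with \<open>?C \<subseteq> U \<union> - K\<close> have "?C \<subseteq> U" by blast
    then have "bounded ?C" using assms(1,4) by (meson bounded_subset subset_trans)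
    then show "x \<in> inside (K - U)" using x by (auto simp: inside_def)
  qed
  have O: "- K \<subseteq> outside (K - U)"
  proof
    fix x assume x: "x \<in> - K"
    then have x0: "x \<noteq> 0" using zero by auto
    let ?R = "(\<lambda>s::real. s *\<^sub>R x) ` {1..}"
    have "connected ?R"
      by (intro connected_continuous_image continuous_intros) simp
    moreover have RK: "?R \<subseteq> - (K - U)"
    proof -
      have "s *\<^sub>R x \<notin> K" if "s \<ge> 1" for s
        using star[of "s *\<^sub>R x" "1/s"] that x by auto
      then show ?thesis by auto
    qed
    moreover have "x \<in> ?R" by (intro image_eqI[of _ _ 1]) auto
    ultimately have "?R \<subseteq> connected_component_set (- (K - U)) x"
      by (simp add: connected_component_maximal)
    moreover have "\<not> bounded ?R"
    proof
      assume "bounded ?R"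
      then obtain B where B: "\<And>s. s \<ge> 1 \<Longrightarrow> norm (s *\<^sub>R x) \<le> B"
        unfolding bounded_iff by auto
      have "norm ((\<bar>B\<bar> / norm x + 1) *\<^sub>R x) \<le> B" by (rule B) simp
      moreover have "norm ((\<bar>B\<bar> / norm x + 1) *\<^sub>R x) = \<bar>B\<bar> + norm x"
        using x0 by (simp add: field_simps)
      ultimately show False using x0 by (smt (verit) zero_less_norm_iff)
    qed
    ultimately show "x \<in> outside (K - U)"
      using x bounded_subset by (auto simp: outside_def)
  qed
  have disj: "inside (K - U) \<inter> outside (K - U) = {}" "inside (K - U) \<inter> (K - U) = {}"
    "outside (K - U) \<inter> (K - U) = {}"
    by (auto simp: inside_def outside_def)
  show "inside (K - U) = U" "outside (K - U) = - K"
    using U O disj assms(4) by blast+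
qed

text \<open>The criterion is Cauchy--Schwarz for the positive part of the form.\<close>

lemma indefinite_form_on_plane:
  fixes n1 n2 n3 d1 d2 d3 :: real
  assumes "d1 < 0" "0 < d2" "0 < d3" and n: "n1 \<noteq> 0 \<or> n2 \<noteq> 0 \<or> n3 \<noteq> 0"
  shows "(\<forall>v1 v2 v3. v1*n1 + v2*n2 + v3*n3 = 0 \<longrightarrow> d1* v1^2 + d2* v2^2 + d3* v3^2 \<ge> 0)
     \<longleftrightarrow> n1^2/d1 + n2^2/d2 + n3^2/d3 \<le> 0"
proof
  define q where "q = n2^2/d2 + n3^2/d3"
  have q0: "q \<ge> 0" unfolding q_def using assms by auto
  assume H: "\<forall>v1 v2 v3. v1*n1 + v2*n2 + v3*n3 = 0 \<longrightarrow> d1* v1^2 + d2* v2^2 + d3* v3^2 \<ge> 0"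
  show "n1^2/d1 + n2^2/d2 + n3^2/d3 \<le> 0"
  proof (cases "n1 = 0")
    case True
    then show ?thesis using H[rule_format, of 1 0 0] assms by auto
  next
    case False
    \<comment> \<open>The test vector \<open>(-q/n1, n2/d2, n3/d3)\<close> lies in the plane; its
      last two entries are the equality case of Cauchy--Schwarz for the positive part.\<close>
    have "d1*(-q/n1)^2 + d2*(n2/d2)^2 + d3*(n3/d3)^2 \<ge> 0"
      using assms False by (intro H[rule_format]) (simp add: q_def field_simps power2_eq_square)
    moreover have "d2*(n2/d2)^2 + d3*(n3/d3)^2 = q"
      using assms by (simp add: q_def field_simps power2_eq_square)
    ultimately have "0 \<le> d1 * q^2 / n1^2 + q" by (simp add: power_divide)
    also have "d1 * q^2 / n1^2 + q = q * (d1 * q + n1^2) / n1^2"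
      using False by (simp add: field_simps power2_eq_square)
    finally have 1: "0 \<le> q * (d1 * q + n1^2)"
      using False zero_less_power2[of n1] by (simp add: zero_le_divide_iff)
    have "d1 * q + n1^2 \<ge> 0"
    proof (cases "q = 0")
      case False then show ?thesis using 1 q0 by (simp add: zero_le_mult_iff)
    qed auto
    then have "n1^2/d1 + q \<le> 0" using assms(1) by (simp add: field_simps)
    then show ?thesis by (simp add: q_def)
  qed
next
  define q where "q = n2^2/d2 + n3^2/d3"
  assume "n1^2/d1 + n2^2/d2 + n3^2/d3 \<le> 0"
  then have q: "d1 * q + n1^2 \<ge> 0" using assms(1) by (simp add: q_def field_simps)
  have q0: "q \<ge> 0" unfolding q_def using assms by auto
  have n1: "n1 \<noteq> 0"
  proof
    assume "n1 = 0"
    then have "q \<le> 0" using q assms(1) by (simp add: zero_le_mult_iff)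
    moreover have "n2^2/d2 \<ge> 0" "n3^2/d3 \<ge> 0" using assms by auto
    ultimately have "n2^2/d2 = 0" "n3^2/d3 = 0" unfolding q_def by linarith+
    then show False using assms \<open>n1 = 0\<close> by auto
  qed
  show "\<forall>v1 v2 v3. v1*n1 + v2*n2 + v3*n3 = 0 \<longrightarrow> d1* v1^2 + d2* v2^2 + d3* v3^2 \<ge> 0"
  proof (intro allI impI)
    fix v1 v2 v3 :: real
    define w where "w = d2* v2^2 + d3* v3^2"
    assume "v1*n1 + v2*n2 + v3*n3 = 0"
    then have "v1*n1 = -(v2*n2 + v3*n3)" by linarith
    then have e: "v1^2*n1^2 = (v2*n2 + v3*n3)^2" by (metis power2_minus power_mult_distrib)
    \<comment> \<open>Lagrange's identity: the Cauchy--Schwarz defect is a square.\<close>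
    have "w * q - (v2*n2 + v3*n3)^2 = (d2* v2*n3 - d3* v3*n2)^2 / (d2*d3)"
      unfolding w_def q_def using assms by (simp add: field_simps power2_eq_square)
    moreover have "\<dots> \<ge> 0" using assms by auto
    ultimately have "v1^2*n1^2 \<le> w * q" using e by linarith
    then have "-d1 * (v1^2*n1^2) \<le> -d1 * (w * q)" using assms(1) by (intro mult_left_mono) auto
    also have "\<dots> = w * (-d1 * q)" by simp
    also have "\<dots> \<le> w * n1^2"
      using q assms by (intro mult_left_mono) (auto simp: w_def)
    finally have "(-d1 * v1^2) * n1^2 \<le> w * n1^2" by (simp add: mult.assoc)
    then have "-d1 * v1^2 \<le> w" using n1 by (metis mult_le_cancel_right_pos zero_less_power2)
    then show "d1* v1^2 + d2* v2^2 + d3* v3^2 \<ge> 0" unfolding w_def by linarith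
  qed
qed

section \<open>Sums of double poles\<close>

text \<open>The function \<open>F\<close> of the overview for arbitrary poles \<open>- p i\<close>
  and masses \<open>m i\<close>. Since \<open>p\<close> may have any sign, replacing
  \<open>t\<close> by \<open>- t\<close> stays within this family.\<close>

definition pole_sum :: "('i::finite \<Rightarrow> real) \<Rightarrow> ('i \<Rightarrow> real) \<Rightarrow> real \<Rightarrow> real" where
  "pole_sum p m t = (\<Sum>i\<in>UNIV. m i / (p i + t)^2)"

text \<open>Reflection transfers results about the leftmost poles to the rightmost ones, so that
  only one direction is proved by hand.\<close>

lemma pole_sum_minus: "pole_sum (\<lambda>i. - p i) m t = pole_sum p m (- t)"
proof -
  have "(- p i + t)^2 = (p i + - t)^2" for i by (simp add: power2_commute)
  then show ?thesis unfolding pole_sum_def by simp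
qed

lemma continuous_on_pole_sum:
  assumes "\<And>i t. t \<in> T \<Longrightarrow> m i \<noteq> 0 \<Longrightarrow> p i + t \<noteq> 0"
  shows "continuous_on T (pole_sum p m)"
proof -
  have "continuous_on T (\<lambda>t. m i / (p i + t)^2)" for i
  proof (cases "m i = 0")
    case False
    then show ?thesis using assms by (intro continuous_intros) auto
  qed auto
  then show ?thesis unfolding pole_sum_def by (intro continuous_on_sum)
qed

lemma pole_sum_at_top:
  assumes "\<And>i. m i \<ge> 0" "m j > 0"
  shows "filterlim (pole_sum p m) at_top (at (- p j))"
proof (rule filterlim_at_top_mono)
  have "filterlim (\<lambda>x. (p j + x)^2) (at_right 0) (at (- p j))"
    unfolding filterlim_at
    by (auto simp: eventually_at_filter eq_neg_iff_add_eq_0 add.commute intro!: tendsto_eq_intros)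
  then show "filterlim (\<lambda>t. m j / (p j + t)^2) at_top (at (- p j))"
    using assms(2) unfolding divide_inverse
    by (intro filterlim_tendsto_pos_mult_at_top[OF tendsto_const]
        filterlim_compose[OF filterlim_inverse_at_top_right])
  show "\<forall>\<^sub>F x in at (- p j). m j / (p j + x)^2 \<le> pole_sum p m x"
    unfolding pole_sum_def using assms(1) by (intro always_eventually allI member_le_sum) auto
qed

lemma pole_sum_at_bot: "(pole_sum p m \<longlongrightarrow> 0) at_bot"
proof -
  have "filterlim (\<lambda>t. (p i + t)^2) at_infinity at_bot" for i
  proof -
    have "filterlim (\<lambda>t. p i + t) at_bot at_bot"
      unfolding filterlim_at_bot eventually_at_bot_linorder
      by (metis add.commute le_diff_eq)
    then show ?thesis
      by (intro filterlim_at_top_imp_at_infinity filterlim_pow_at_bot_even) auto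
  qed
  then have "((\<lambda>t. m i / (p i + t)^2) \<longlongrightarrow> 0) at_bot" for i
    by (intro tendsto_divide_0[OF tendsto_const])
  then show ?thesis unfolding pole_sum_def using tendsto_sum[of UNIV "\<lambda>i t. m i / (p i + t)^2" "\<lambda>_. 0"] by auto
qed

text \<open>Strict convexity of \<open>1 / x^2\<close> on either half-line. For positive arguments,
  clearing denominators leaves \<open>(v - u)^2 * (v + 2*u) > 0\<close>; negative arguments follow
  by changing both signs.\<close>

lemma inverse_square_above_tangent:
  fixes u v :: real
  assumes "u * v > 0" "u \<noteq> v"
  shows "1/u^2 > 1/v^2 - 2*(u - v)/v^3"
proof -
  have *: "1/u^2 > 1/v^2 - 2*(u - v)/v^3" if "u > 0" "v > 0" "u \<noteq> v" for u v :: real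
  proof -
    have "(v - u)^2 * (v + 2*u) > 0" using that by auto
    also have "(v - u)^2 * (v + 2*u) = v^3 - u^2 * (3* v - 2*u)" by algebra
    finally have "u^2 * (3* v - 2*u) < v^3" by simp
    moreover have "1/v^2 - 2*(u - v)/v^3 = (3* v - 2*u)/v^3"
      using that by (simp add: field_simps power2_eq_square power3_eq_cube)
    moreover have "(3 * v - 2*u)/v^3 < 1/u^2"
      using \<open>u^2 * (3* v - 2*u) < v^3\<close> that by (simp add: pos_divide_less_eq pos_less_divide_eq mult.commute)
    ultimately show ?thesis by simp
  qed
  show ?thesis
  proof (cases "u > 0")
    case True then show ?thesis using * assms by (simp add: zero_less_mult_iff)
  next
    case False
    then have "-u > 0" "-v > 0" "-u \<noteq> -v" using assms by (auto simp: zero_less_mult_iff)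
    from *[OF this] show ?thesis by (simp add: diff_divide_distrib algebra_simps)
  qed
qed

text \<open>The sign hypothesis keeps active poles out of \<open>[x, z]\<close>, so the tangent-line
  bounds at \<open>y\<close> add up to one with slope \<open>D\<close>, the derivative at
  \<open>y\<close>. The endpoint towards which this tangent does not descend has the larger
  value.\<close>

lemma pole_sum_strict_quasiconvex:
  assumes m: "\<And>i. m i \<ge> 0" "m j > 0" and xyz: "x < y" "y < z"
    and sgn: "\<And>i. m i > 0 \<Longrightarrow> (p i + x) * (p i + z) > 0"
  shows "pole_sum p m y < max (pole_sum p m x) (pole_sum p m z)"
proof -
  define D where "D = (\<Sum>i\<in>UNIV. - 2 * m i / (p i + y)^3)"
  have sg: "(p i + x) * (p i + y) > 0 \<and> (p i + z) * (p i + y) > 0" if "m i > 0" for i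
    using sgn[OF that] xyz by (auto simp: zero_less_mult_iff)
  have tang: "pole_sum p m w > pole_sum p m y + (w - y) * D" if w: "w = x \<or> w = z" for w
  proof -
    have str: "m i / (p i + w)^2 > m i / (p i + y)^2 + (w - y) * (- 2 * m i / (p i + y)^3)"
      if "m i > 0" for i
    proof -
      have "1/(p i + w)^2 > 1/(p i + y)^2 - 2*((p i + w) - (p i + y))/(p i + y)^3"
        using sg[OF that] w xyz by (intro inverse_square_above_tangent) auto
      then have "m i * (1/(p i + w)^2) > m i * (1/(p i + y)^2 - 2*(w - y)/(p i + y)^3)"
        using that by (intro mult_strict_left_mono) auto
      then show ?thesis by (simp add: algebra_simps)
    qed
    have "(\<Sum>i\<in>UNIV. m i / (p i + w)^2)
        > (\<Sum>i\<in>UNIV. m i / (p i + y)^2 + (w - y) * (- 2 * m i / (p i + y)^3))"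
    proof (rule sum_strict_mono_ex1)
      show "\<forall>i\<in>UNIV. m i / (p i + y)^2 + (w - y) * (- 2 * m i / (p i + y)^3) \<le> m i / (p i + w)^2"
        using str m(1) by (metis order.order_iff_strict mult_zero_right div_0 add.right_neutral)
    qed (use str m(2) in auto)
    then show ?thesis unfolding pole_sum_def D_def by (simp only: sum.distrib sum_distrib_left)
  qed
  show ?thesis
  proof (cases "D \<le> 0")
    case True
    then have "(x - y) * D \<ge> 0" using xyz by (intro mult_nonpos_nonpos) auto
    then show ?thesis using tang[of x] by auto
  next
    case False
    then have "(z - y) * D \<ge> 0" using xyz by auto
    then show ?thesis using tang[of z] by auto
  qed
qed

lemma pole_sum_strict_mono:
  assumes m: "\<And>i. m i \<ge> 0" "m j > 0" and xy: "x < y"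
    and neg: "\<And>i. m i > 0 \<Longrightarrow> p i + y < 0"
  shows "pole_sum p m x < pole_sum p m y"
  unfolding pole_sum_def
proof (rule sum_strict_mono_ex1)
  have str: "m i / (p i + x)^2 < m i / (p i + y)^2" if "m i > 0" for i
  proof -
    have "(p i + y)^2 < (p i + x)^2"
      using neg[OF that] xy power_strict_mono[of "-(p i + y)" "-(p i + x)" 2]
      by (simp only: power2_minus)
    then show ?thesis using neg[OF that] that xy
      by (intro divide_strict_left_mono) (auto simp: zero_less_mult_iff)
  qed
  show "\<forall>i\<in>UNIV. m i / (p i + x)^2 \<le> m i / (p i + y)^2"
    using str m(1) by (metis order.order_iff_strict div_0)
  show "\<exists>i\<in>UNIV. m i / (p i + x)^2 < m i / (p i + y)^2" using str m(2) by auto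
qed simp

section \<open>Counting roots on one interval\<close>

lemma ex_gt_near_right:
  fixes f :: "real \<Rightarrow> real"
  assumes "filterlim f at_top (at_right p)" "p < s"
  obtains x where "p < x" "x < s" "f x > y"
proof -
  have "eventually (\<lambda>x. f x > y) (at_right p)"
    using assms(1) by (simp add: filterlim_at_top_dense)
  then obtain b where b: "b > p" "\<And>x. p < x \<Longrightarrow> x < b \<Longrightarrow> f x > y"
    unfolding eventually_at_right_field by auto
  obtain x where "p < x" "x < min b s" using dense[of p "min b s"] b(1) assms(2) by auto
  with b show thesis by (intro that[of x]) auto
qed

lemma ex_gt_near_left:
  fixes f :: "real \<Rightarrow> real"
  assumes "filterlim f at_top (at_left q)" "s < q"
  obtains x where "s < x" "x < q" "f x > y"
proof -
  have "eventually (\<lambda>x. f x > y) (at_left q)"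
    using assms(1) by (simp add: filterlim_at_top_dense)
  then obtain b where b: "b < q" "\<And>x. b < x \<Longrightarrow> x < q \<Longrightarrow> f x > y"
    unfolding eventually_at_left_field by auto
  obtain x where "max b s < x" "x < q" using dense[of "max b s" q] b(1) assms(2) by auto
  with b show thesis by (intro that[of x]) auto
qed

text \<open>The intermediate value theorem gives a root on each side of \<open>s\<close>. Of three
  roots the middle one would lie strictly below the level of the outer two, so there is no
  third.\<close>

lemma card_roots_of_well:
  fixes f :: "real \<Rightarrow> real"
  assumes cont: "continuous_on {p<..<q} f"
    and top: "filterlim f at_top (at_right p)" "filterlim f at_top (at_left q)"
    and conv: "\<And>x z. p < x \<Longrightarrow> x < z \<Longrightarrow> z < q \<Longrightarrow> \<forall>y. x < y \<and> y < z \<longrightarrow> f y < max (f x) (f z)"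
    and s: "p < s" "s < q" "f s < y"
  shows "card {t. p < t \<and> t < q \<and> f t = y} = 2"
proof -
  obtain x where x: "p < x" "x < s" "f x > y" using ex_gt_near_right[OF top(1) s(1)] .
  obtain z where z: "s < z" "z < q" "f z > y" using ex_gt_near_left[OF top(2) s(2)] .
  have "continuous_on {x..s} f" "continuous_on {s..z} f"
    using x z s by (auto intro!: continuous_on_subset[OF cont])
  then obtain r r' where r: "x \<le> r" "r \<le> s" "f r = y" and r': "s \<le> r'" "r' \<le> z" "f r' = y"
    using IVT2'[of f s y x] IVT'[of f s y z] x z s by (metis less_imp_le)
  have rr: "r < r'" using r r' s by (smt (verit))
  have "t \<in> {r, r'}" if t: "p < t" "t < q" "f t = y" for t
  proof (rule ccontr)
    assume "t \<notin> {r, r'}"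
    then consider "t < r" | "r < t" "t < r'" | "r' < t" by fastforce
    then show False
    proof cases
      case 1 then show False using conv[of t r'] t r r' rr x z by auto
    next
      case 2 then show False using conv[of r r'] t r r' x z by auto
    next
      case 3 then show False using conv[of r t] t r r' rr x z by auto
    qed
  qed
  then have "{t. p < t \<and> t < q \<and> f t = y} = {r, r'}"
    using r r' x z by auto
  then show ?thesis using rr by auto
qed

text \<open>Between two points at the minimal level \<open>y\<close>, strict quasiconvexity would
  give a value below \<open>y\<close>.\<close>

lemma card_roots_at_minimum:
  fixes f :: "real \<Rightarrow> real"
  assumes conv: "\<And>x z. p < x \<Longrightarrow> x < z \<Longrightarrow> z < q \<Longrightarrow> \<forall>y. x < y \<and> y < z \<longrightarrow> f y < max (f x) (f z)"
    and ge: "\<And>s. p < s \<Longrightarrow> s < q \<Longrightarrow> f s \<ge> y"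
    and s: "p < s" "s < q" "f s = y"
  shows "card {t. p < t \<and> t < q \<and> f t = y} = 1"
proof -
  have no: "\<not> (x < z \<and> p < x \<and> z < q \<and> f x = y \<and> f z = y)" for x z
    using conv[of x z] ge dense[of x z] by (metis max.idem not_less order.strict_trans)
  have "t = s" if "p < t" "t < q" "f t = y" for t
    using no[of t s] no[of s t] that s by (cases t s rule: linorder_cases) auto
  then have "{t. p < t \<and> t < q \<and> f t = y} = {s}" using s by blast
  then show ?thesis by simp
qed

lemma card_roots_below_pole:
  fixes f :: "real \<Rightarrow> real"
  assumes cont: "continuous_on {..<q} f" and top: "filterlim f at_top (at_left q)"
    and bot: "(f \<longlongrightarrow> 0) at_bot"
    and mono: "\<And>x z. x < z \<Longrightarrow> z < q \<Longrightarrow> f x < f z" and y: "y > 0"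
  shows "card {t. t < q \<and> f t = y} = 1"
proof -
  have "eventually (\<lambda>x. f x < y) at_bot" using order_tendstoD(2)[OF bot y] .
  then obtain N where "\<And>n. n \<le> N \<Longrightarrow> f n < y" unfolding eventually_at_bot_linorder by auto
  then have x: "min N (q - 1) < q" "f (min N (q - 1)) < y" by auto
  define x where "x = min N (q - 1)"
  obtain z where z: "x < z" "z < q" "f z > y" using ex_gt_near_left[OF top, of x y] x x_def by auto
  have "continuous_on {x..z} f" using z by (auto intro!: continuous_on_subset[OF cont])
  then obtain r where r: "x \<le> r" "r \<le> z" "f r = y"
    using IVT'[of f x y z] z x x_def by force
  have "t = r" if "t < q" "f t = y" for t
    using mono[of t r] mono[of r t] that r z by (cases t r rule: linorder_cases) auto
  then have "{t. t < q \<and> f t = y} = {r}" using r z le_less_trans by blast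
  then show ?thesis by simp
qed

context
  fixes p m :: "'i::finite \<Rightarrow> real"
  assumes nonneg: "\<And>i. m i \<ge> 0"
begin

lemma pole_sum_at_top_side:
  assumes "m j > 0"
  shows "filterlim (pole_sum p m) at_top (at_left (- p j))"
    and "filterlim (pole_sum p m) at_top (at_right (- p j))"
  using pole_sum_at_top[of m j p, OF nonneg assms] by (simp_all add: filterlim_at_split)

lemma pole_sum_quasiconvex_gap:
  assumes "m i > 0" and free: "\<And>l. m l > 0 \<Longrightarrow> - p l \<le> x0 \<or> z0 \<le> - p l"
    and "x0 < x" "x < z" "z < z0"
  shows "\<forall>y. x < y \<and> y < z \<longrightarrow> pole_sum p m y < max (pole_sum p m x) (pole_sum p m z)"
proof (intro allI impI)
  fix y assume "x < y \<and> y < z"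
  then show "pole_sum p m y < max (pole_sum p m x) (pole_sum p m z)"
    using assms(3-) by (intro pole_sum_strict_quasiconvex[of m i, OF nonneg assms(1)])
      (auto simp: zero_less_mult_iff dest!: free)
qed

lemma card_pole_sum_roots_gap:
  assumes i: "m i > 0" and j: "m j > 0"
    and free: "\<And>l. m l > 0 \<Longrightarrow> - p l \<le> - p i \<or> - p j \<le> - p l"
  shows "- p i < s \<Longrightarrow> s < - p j \<Longrightarrow> pole_sum p m s < y
      \<Longrightarrow> card {t. - p i < t \<and> t < - p j \<and> pole_sum p m t = y} = 2"
    and "\<lbrakk>\<And>s. - p i < s \<Longrightarrow> s < - p j \<Longrightarrow> pole_sum p m s \<ge> y;
      - p i < s; s < - p j; pole_sum p m s = y\<rbrakk>
      \<Longrightarrow> card {t. - p i < t \<and> t < - p j \<and> pole_sum p m t = y} = 1"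
proof -
  have cont: "continuous_on {- p i<..<- p j} (pole_sum p m)"
  proof (rule continuous_on_pole_sum)
    fix l t assume "t \<in> {- p i<..<- p j}" "m l \<noteq> 0"
    then show "p l + t \<noteq> 0" using free[of l] nonneg[of l] by force
  qed
  show "- p i < s \<Longrightarrow> s < - p j \<Longrightarrow> pole_sum p m s < y
      \<Longrightarrow> card {t. - p i < t \<and> t < - p j \<and> pole_sum p m t = y} = 2"
    using card_roots_of_well[OF cont pole_sum_at_top_side(2)[OF i] pole_sum_at_top_side(1)[OF j]
      pole_sum_quasiconvex_gap[OF i free]] by blast
  show "\<lbrakk>\<And>s. - p i < s \<Longrightarrow> s < - p j \<Longrightarrow> pole_sum p m s \<ge> y;
      - p i < s; s < - p j; pole_sum p m s = y\<rbrakk>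
      \<Longrightarrow> card {t. - p i < t \<and> t < - p j \<and> pole_sum p m t = y} = 1"
    using card_roots_at_minimum[OF pole_sum_quasiconvex_gap[OF i free]] by blast
qed

lemma card_pole_sum_roots_below:
  assumes i: "m i > 0" and free: "\<And>l. m l > 0 \<Longrightarrow> - p i \<le> - p l" and "y > 0"
  shows "card {t. t < - p i \<and> pole_sum p m t = y} = 1"
proof (rule card_roots_below_pole[OF _ pole_sum_at_top_side(1)[OF i] pole_sum_at_bot _ assms(3)])
  show "continuous_on {..<- p i} (pole_sum p m)"
  proof (rule continuous_on_pole_sum)
    fix l t assume "t \<in> {..<- p i}" "m l \<noteq> 0"
    then show "p l + t \<noteq> 0" using free[of l] nonneg[of l] by force
  qed
  show "pole_sum p m x < pole_sum p m z" if "x < z" "z < - p i" for x z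
    using that by (intro pole_sum_strict_mono[of m i, OF nonneg i]) (auto dest!: free)
qed

end

lemma card_pole_sum_roots_mirror:
  "card {t. P (- t) \<and> pole_sum (\<lambda>i. - p i) m t = y} = card {t. P t \<and> pole_sum p m t = y}"
proof -
  have "bij_betw uminus {t. P (- t) \<and> pole_sum (\<lambda>i. - p i) m t = y} {t. P t \<and> pole_sum p m t = y}"
    by (intro bij_betwI[of _ _ _ uminus]) (auto simp: pole_sum_minus)
  then show ?thesis by (rule bij_betw_same_card)
qed

lemma card_pole_sum_roots_above:
  assumes "\<And>i. m i \<ge> 0" "m i > 0" and free: "\<And>l. m l > 0 \<Longrightarrow> - p l \<le> - p i" and "y > 0"
  shows "card {t. t > - p i \<and> pole_sum p m t = y} = 1"
  using card_pole_sum_roots_below[of m i "\<lambda>i. - p i" y] assms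
    card_pole_sum_roots_mirror[of "\<lambda>t. t > - p i" p m y]
  by (simp add: minus_less_iff)

text \<open>As \<open>x / 0 = 0\<close>, a term with \<open>m i = 0\<close> vanishes even at \<open>- p i\<close>, while an active pole gives a
  junk value there; \<open>off_poles\<close> excludes exactly the latter points.\<close>

definition off_poles :: "('i \<Rightarrow> real) \<Rightarrow> ('i \<Rightarrow> real) \<Rightarrow> real \<Rightarrow> bool" where
  "off_poles p m t \<longleftrightarrow> (\<forall>i. p i + t = 0 \<longrightarrow> m i = 0)"

lemma off_poles_minus: "off_poles (\<lambda>i. - p i) m t = off_poles p m (- t)"
proof -
  have "- p i + t = 0 \<longleftrightarrow> p i + - t = 0" for i by auto
  then show ?thesis unfolding off_poles_def by simp
qed

section \<open>Finiteness and one-sided root counts\<close>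

lemma infinite_obtain_increasing_triple:
  fixes S :: "'a::linorder set"
  assumes "infinite S"
  obtains x y z where "x \<in> S" "y \<in> S" "z \<in> S" "x < y" "y < z"
proof -
  obtain a where a: "a \<in> S" using assms by (metis ex_in_conv finite.emptyI)
  have "infinite (S - {a})" using assms by simp
  then obtain b where b: "b \<in> S - {a}" by (metis ex_in_conv finite.emptyI)
  have "infinite (S - {a} - {b})" using assms by simp
  then obtain c where c: "c \<in> S - {a} - {b}" by (metis ex_in_conv finite.emptyI)
  show thesis using a b c that by (metis Diff_iff insertI1 linorder_less_linear)
qed

text \<open>Sort the roots by the set \<open>side t\<close> of indices whose pole lies to the left
  of \<open>t\<close>. By pigeonhole, infinitely many roots would include three with no active pole
  between them, contradicting strict quasiconvexity.\<close>

lemma finite_pole_sum_roots: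
  fixes p m :: "'i::finite \<Rightarrow> real"
  assumes "\<And>i. m i \<ge> 0" "m j > 0"
  shows "finite {t. off_poles p m t \<and> pole_sum p m t = y}"
proof (rule ccontr)
  define side where "side t = {i. p i + t > 0}" for t
  let ?R = "{t. off_poles p m t \<and> pole_sum p m t = y}"
  assume "infinite ?R"
  then obtain v where "infinite (side -` {v} \<inter> ?R)"
    using inf_img_fin_dom'[of side ?R] by (meson finite_class.finite)
  then obtain r s t where rst: "r \<in> side -` {v} \<inter> ?R" "s \<in> side -` {v} \<inter> ?R" "t \<in> side -` {v} \<inter> ?R"
    "r < s" "s < t" by (rule infinite_obtain_increasing_triple)
  have "pole_sum p m s < max (pole_sum p m r) (pole_sum p m t)"
  proof (rule pole_sum_strict_quasiconvex[of m j, OF assms rst(4,5)])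
    fix i assume i: "m i > 0"
    have "p i + r \<noteq> 0" "p i + t \<noteq> 0" using rst i unfolding off_poles_def by auto
    moreover have "p i + r > 0 \<longleftrightarrow> p i + t > 0" using rst unfolding side_def by auto
    ultimately show "(p i + r) * (p i + t) > 0" by (auto simp: zero_less_mult_iff)
  qed
  then show False using rst by simp
qed

text \<open>The second summand accounts for the symmetric pair of feet that replaces an inactive pole.\<close>

definition half_count :: "('i::finite \<Rightarrow> real) \<Rightarrow> ('i \<Rightarrow> real) \<Rightarrow> 'i \<Rightarrow> 'i \<Rightarrow> nat" where
  "half_count p m i j = card {t. t < - p j \<and> off_poles p m t \<and> pole_sum p m t = 1}
     + (if m i = 0 \<and> pole_sum p m (- p i) < 1 then 2 else 0)"

context
  fixes p m :: "'i::finite \<Rightarrow> real" and i j :: 'i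
  assumes nonneg: "\<And>i. m i \<ge> 0" and mj: "m j > 0"
    and pij: "p j < p i" and others: "\<And>l. l \<noteq> i \<Longrightarrow> p l \<le> p j"
begin

text \<open>\<open>- p i\<close> is the only pole left of \<open>- p j\<close>, as every other pole
  lies at or to the right of \<open>- p j\<close>.\<close>

lemma off_poles_left_iff: "t < - p j \<Longrightarrow> off_poles p m t \<longleftrightarrow> (t = - p i \<longrightarrow> m i = 0)"
proof -
  assume t: "t < - p j"
  have "l = i" if "p l + t = 0" for l
    using others[of l] t that by (cases "l = i") auto
  moreover have "p i + t = 0 \<longleftrightarrow> t = - p i" by auto
  ultimately show ?thesis unfolding off_poles_def by blast
qed

lemma pole_free_gap: "m l > 0 \<Longrightarrow> - p l \<le> - p i \<or> - p j \<le> - p l"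
  using others[of l] by (cases "l = i") auto

text \<open>An active pole at \<open>- p i\<close> cuts the half-line left of \<open>- p j\<close>
  into a ray, which carries one root, and the gap.\<close>

lemma half_count_pole:
  assumes "m i > 0"
  shows "half_count p m i j = 1 + card {t. - p i < t \<and> t < - p j \<and> pole_sum p m t = 1}"
proof -
  let ?A = "{t. t < - p i \<and> pole_sum p m t = 1}"
  let ?B = "{t. - p i < t \<and> t < - p j \<and> pole_sum p m t = 1}"
  have cA: "card ?A = 1"
  proof (rule card_pole_sum_roots_below[of m i p, OF nonneg assms])
    show "- p i \<le> - p l" for l using others[of l] pij by (cases "l = i") auto
  qed simp
  have AB: "{t. t < - p j \<and> off_poles p m t \<and> pole_sum p m t = 1} = ?A \<union> ?B"
    using off_poles_left_iff assms pij by (auto simp: neq_iff)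
  have "finite {t. t < - p j \<and> off_poles p m t \<and> pole_sum p m t = 1}"
    by (rule finite_subset[OF _ finite_pole_sum_roots[of m j p 1, OF nonneg mj]]) auto
  then have fin: "finite ?A" "finite ?B" unfolding AB by simp_all
  have "?A \<inter> ?B = {}" by auto
  then show "half_count p m i j = 1 + card ?B"
    unfolding half_count_def AB using cA fin assms by (simp add: card_Un_disjoint)
qed

lemma half_count_no_pole:
  assumes "m i = 0"
  shows "half_count p m i j = 1 + (if pole_sum p m (- p i) < 1 then 2 else 0)"
proof -
  have eq: "{t. t < - p j \<and> off_poles p m t \<and> pole_sum p m t = 1} = {t. t < - p j \<and> pole_sum p m t = 1}"
    using off_poles_left_iff assms by auto
  have c: "card {t. t < - p j \<and> pole_sum p m t = 1} = 1"
  proof (rule card_pole_sum_roots_below[of m j p, OF nonneg mj])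
    show "- p j \<le> - p l" if "m l > 0" for l using that others[of l] assms by (cases "l = i") auto
  qed simp
  show "half_count p m i j = 1 + (if pole_sum p m (- p i) < 1 then 2 else 0)"
    unfolding half_count_def eq using c assms by simp
qed

text \<open>The count is 1 + 2 in both cases: with an active pole at \<open>- p i\<close> the dip
  gives two roots in the gap; with an inactive one, monotonicity carries the dip down to
  \<open>- p i\<close> and so yields the pair of feet.\<close>

lemma half_count_inside:
  assumes s: "- p i < s" "s < - p j" "pole_sum p m s < 1"
  shows "half_count p m i j = 3"
proof (cases "m i = 0")
  case True
  have "pole_sum p m (- p i) < pole_sum p m s"
  proof (intro pole_sum_strict_mono[of m j, OF nonneg mj])
    show "p l + s < 0" if "m l > 0" for l using that True others[of l] s by (cases "l = i") auto
  qed (use s in auto)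
  then show ?thesis using half_count_no_pole[OF True] s by simp
next
  case False
  then have mi: "m i > 0" using nonneg[of i] by simp
  show ?thesis using half_count_pole[OF mi] card_pole_sum_roots_gap(1)[of m i j p, OF nonneg mi mj pole_free_gap s] by simp
qed

text \<open>The range includes the end \<open>- p i\<close>: if that pole is inactive, the value
  there decides whether the pair of feet exists.\<close>

lemma half_count_outside:
  assumes "\<And>s. - p i \<le> s \<Longrightarrow> s < - p j \<Longrightarrow> off_poles p m s \<Longrightarrow> pole_sum p m s > 1"
  shows "half_count p m i j = 1"
proof (cases "m i = 0")
  case True
  have "off_poles p m (- p i)" using True off_poles_left_iff pij by simp
  then have "pole_sum p m (- p i) > 1" using assms[of "- p i"] pij by simp
  then show ?thesis using half_count_no_pole[OF True] by simp
next
  case False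
  then have mi: "m i > 0" using nonneg[of i] by simp
  have "\<not> (- p i < s \<and> s < - p j \<and> pole_sum p m s = 1)" for s
    using off_poles_left_iff[of s] assms[of s] by auto
  then have "{t. - p i < t \<and> t < - p j \<and> pole_sum p m t = 1} = {}" by blast
  then show ?thesis using half_count_pole[OF mi] by (simp only: card.empty)
qed

lemma half_count_boundary:
  assumes mi: "m i > 0" and "\<And>s. - p i < s \<Longrightarrow> s < - p j \<Longrightarrow> pole_sum p m s \<ge> 1"
    and "- p i < s" "s < - p j" "pole_sum p m s = 1"
  shows "half_count p m i j = 2"
proof -
  show ?thesis using half_count_pole[OF mi] card_pole_sum_roots_gap(2)[of m i j p, OF nonneg mi mj pole_free_gap assms(2-)] by simp
qed

end

section \<open>The total count from the behaviour on the two gaps\<close>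

definition full_count :: "('i::finite \<Rightarrow> real) \<Rightarrow> ('i \<Rightarrow> real) \<Rightarrow> nat" where
  "full_count p m = card {t. off_poles p m t \<and> pole_sum p m t = 1}
     + (\<Sum>l\<in>UNIV. if m l = 0 \<and> pole_sum p m (- p l) < 1 then 2 else 0)"

lemma full_count_minus: "full_count (\<lambda>i. - p i) m = full_count p m"
  using card_pole_sum_roots_mirror[of "off_poles p m" p m 1]
  unfolding full_count_def by (simp add: pole_sum_minus off_poles_minus)

lemma pole_sum_strict_antimono:
  assumes "\<And>i. m i \<ge> 0" "m j > 0" and "x < y"
    and "\<And>i. m i > 0 \<Longrightarrow> 0 < p i + x"
  shows "pole_sum p m y < pole_sum p m x"
  using pole_sum_strict_mono[of m j "- y" "- x" "\<lambda>i. - p i"] assms by (force simp: pole_sum_minus)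

definition dips :: "('i::finite \<Rightarrow> real) \<Rightarrow> ('i \<Rightarrow> real) \<Rightarrow> real \<Rightarrow> real \<Rightarrow> bool" where
  "dips p m l u \<longleftrightarrow> (\<exists>s. l < s \<and> s < u \<and> pole_sum p m s < 1)"

text \<open>Closed ends, unlike in \<open>dips\<close>: at an inactive end pole the value is genuine
  and governs a pair of feet. On a gap between neighbouring poles both predicates fail exactly when
  the minimum of the sum over the closed gap, off the active poles, is 1.\<close>

definition stays_above :: "('i::finite \<Rightarrow> real) \<Rightarrow> ('i \<Rightarrow> real) \<Rightarrow> real \<Rightarrow> real \<Rightarrow> bool" where
  "stays_above p m l u \<longleftrightarrow> (\<forall>s. l \<le> s \<and> s \<le> u \<and> off_poles p m s \<longrightarrow> pole_sum p m s > 1)"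

lemma stays_aboveD:
  "stays_above p m l u \<Longrightarrow> l \<le> s \<Longrightarrow> s \<le> u \<Longrightarrow> off_poles p m s \<Longrightarrow> pole_sum p m s > 1"
  unfolding stays_above_def by blast

lemma dips_minus: "dips (\<lambda>i. - p i) m l u = dips p m (- u) (- l)"
  unfolding dips_def pole_sum_minus by (metis minus_less_iff minus_minus)

lemma stays_above_minus: "stays_above (\<lambda>i. - p i) m l u = stays_above p m (- u) (- l)"
  unfolding stays_above_def pole_sum_minus off_poles_minus by (metis minus_le_iff le_minus_iff minus_minus)

text \<open>The active pole \<open>- p j\<close> separates the roots, and those to its right are the
  left-hand roots of the reflected data, in which \<open>k\<close> takes the place of
  \<open>i\<close>.\<close>

lemma full_count_split:
  fixes p m :: "'i::finite \<Rightarrow> real"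
  assumes nonneg: "\<And>i. m i \<ge> 0" and mj: "m j > 0"
    and univ: "UNIV = {i, j, k}" and ord: "p k < p j" "p j < p i"
  shows "full_count p m = half_count p m i j + half_count (\<lambda>i. - p i) m k j"
proof -
  let ?R = "{t. off_poles p m t \<and> pole_sum p m t = 1}"
  let ?A = "{t. t < - p j \<and> off_poles p m t \<and> pole_sum p m t = 1}"
  let ?B = "{t. t > - p j \<and> off_poles p m t \<and> pole_sum p m t = 1}"
  let ?B' = "{t. t < - (- p j) \<and> off_poles (\<lambda>i. - p i) m t \<and> pole_sum (\<lambda>i. - p i) m t = 1}"
  have dist: "i \<noteq> j" "j \<noteq> k" "i \<noteq> k" using ord by auto
  have B: "?B = uminus ` ?B'"
  proof (intro set_eqI iffI)
    fix t assume "t \<in> ?B"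
    then have "- t \<in> ?B'" by (simp add: off_poles_minus pole_sum_minus)
    then have "- (- t) \<in> uminus ` ?B'" by (rule imageI)
    then show "t \<in> uminus ` ?B'" by (simp only: minus_minus)
  qed (auto simp: off_poles_minus pole_sum_minus)
  have cB: "card ?B = card ?B'" unfolding B by (rule card_image) simp
  have "t \<noteq> - p j" if "off_poles p m t" for t using that mj unfolding off_poles_def by force
  then have R: "?R = ?A \<union> ?B" by (auto simp: neq_iff)
  have "?A \<inter> ?B = {}" by auto
  then have "card ?R = card ?A + card ?B"
    using finite_pole_sum_roots[of m j p 1, OF nonneg mj] unfolding R
    by (intro card_Un_disjoint) auto
  moreover have "(\<Sum>l\<in>UNIV. if m l = 0 \<and> pole_sum p m (- p l) < 1 then 2 else 0) =
     (if m i = 0 \<and> pole_sum p m (- p i) < 1 then 2 else 0) + (if m k = 0 \<and> pole_sum p m (- p k) < 1 then 2 else (0::nat))"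
    using dist mj by (subst univ) auto
  ultimately show ?thesis unfolding full_count_def half_count_def using cB by (simp add: pole_sum_minus)
qed

text \<open>Only the leftmost pole is active, with one root on each side of it. To its right the sum
  decreases strictly, so a dip on a gap is decided at the right end of the gap, where the value also
  decides the pair of feet.\<close>

lemma full_count_one_pole:
  fixes p m :: "'i::finite \<Rightarrow> real"
  assumes nonneg: "\<And>i. m i \<ge> 0" and mi: "m i > 0" and mj: "m j = 0" and mk: "m k = 0"
    and univ: "UNIV = {i, j, k}" and ord: "p k < p j" "p j < p i"
    and 1: "dips p m (- p i) (- p j) \<or> stays_above p m (- p i) (- p j)"
    and 2: "dips p m (- p j) (- p k) \<or> stays_above p m (- p j) (- p k)"
  shows "full_count p m = 2 + (if dips p m (- p i) (- p j) then 2 else 0)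
     + (if dips p m (- p j) (- p k) then 2 else 0)"
proof -
  let ?R = "{t. off_poles p m t \<and> pole_sum p m t = 1}"
  let ?A = "{t. t < - p i \<and> pole_sum p m t = 1}"
  let ?B = "{t. t > - p i \<and> pole_sum p m t = 1}"
  have dist: "i \<noteq> j" "j \<noteq> k" "i \<noteq> k" using ord by auto
  have l: "l = i" if "m l > 0" for l using univ that mj mk by (metis UNIV_I empty_iff insert_iff less_irrefl)
  have dec: "pole_sum p m y < pole_sum p m x" if "- p i < x" "x < y" for x y
    using that by (intro pole_sum_strict_antimono[of m i, OF nonneg mi]) (auto dest!: l)
  have off: "off_poles p m t \<longleftrightarrow> t \<noteq> - p i" for t
    using l nonneg mi unfolding off_poles_def
    by (metis add.commute add.right_inverse add_eq_0_iff less_le less_irrefl)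
  have c: "card ?A = 1" "card ?B = 1"
    by (intro card_pole_sum_roots_below[of m i p 1, OF nonneg mi]
        card_pole_sum_roots_above[of m i p 1, OF nonneg mi]; use l in force)+
  then have "finite ?A" "finite ?B" using card_ge_0_finite by force+
  moreover have "?R = ?A \<union> ?B" using off by (auto simp: neq_iff)
  ultimately have "card ?R = 2" using c by (simp add: card_Un_disjoint disjoint_iff)
  moreover have "dips p m (- p i) (- p j) \<longleftrightarrow> pole_sum p m (- p j) < 1"
  proof
    assume "dips p m (- p i) (- p j)"
    then show "pole_sum p m (- p j) < 1" unfolding dips_def using dec less_trans by blast
  next
    assume "pole_sum p m (- p j) < 1"
    then have "\<not> stays_above p m (- p i) (- p j)"
      using stays_aboveD[of p m "- p i" "- p j" "- p j"] off ord by auto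
    then show "dips p m (- p i) (- p j)" using 1 by blast
  qed
  moreover have "dips p m (- p j) (- p k) \<longleftrightarrow> pole_sum p m (- p k) < 1"
  proof
    assume "dips p m (- p j) (- p k)"
    then obtain s where "- p j < s" "s < - p k" "pole_sum p m s < 1" unfolding dips_def by blast
    then show "pole_sum p m (- p k) < 1" using dec[of s "- p k"] ord by simp
  next
    assume "pole_sum p m (- p k) < 1"
    then have "\<not> stays_above p m (- p j) (- p k)"
      using stays_aboveD[of p m "- p j" "- p k" "- p k"] off ord by auto
    then show "dips p m (- p j) (- p k)" using 2 by blast
  qed
  moreover have "(\<Sum>l\<in>UNIV. if m l = 0 \<and> pole_sum p m (- p l) < 1 then 2 else 0) =
     (if pole_sum p m (- p j) < 1 then 2 else 0) + (if pole_sum p m (- p k) < 1 then 2 else (0::nat))"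
    using dist mj mk mi by (subst univ) auto
  ultimately show ?thesis unfolding full_count_def by simp
qed

text \<open>With the middle pole inactive the two gaps form one well. A value below 1 at
  \<open>- p j\<close> gives two roots, a pair of feet and dips on both sides; otherwise
  quasiconvexity allows a dip on at most one side, and a dip gives two roots and no pair.\<close>

lemma full_count_outer_poles:
  fixes p m :: "'i::finite \<Rightarrow> real"
  assumes nonneg: "\<And>i. m i \<ge> 0" and mi: "m i > 0" and mj: "m j = 0" and mk: "m k > 0"
    and univ: "UNIV = {i, j, k}" and ord: "p k < p j" "p j < p i"
    and 1: "dips p m (- p i) (- p j) \<or> stays_above p m (- p i) (- p j)"
    and 2: "dips p m (- p j) (- p k) \<or> stays_above p m (- p j) (- p k)"
  shows "full_count p m = 2 + (if dips p m (- p i) (- p j) then 2 else 0)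
     + (if dips p m (- p j) (- p k) then 2 else 0)"
proof -
  let ?R = "{t. off_poles p m t \<and> pole_sum p m t = 1}"
  let ?A = "{t. t < - p i \<and> pole_sum p m t = 1}"
  let ?G = "{t. - p i < t \<and> t < - p k \<and> pole_sum p m t = 1}"
  let ?B = "{t. t > - p k \<and> pole_sum p m t = 1}"
  have dist: "i \<noteq> j" "j \<noteq> k" "i \<noteq> k" using ord by auto
  have l: "l = i \<or> l = k" if "m l > 0" for l
    using univ that mj by (metis UNIV_I empty_iff insert_iff less_irrefl)
  have off: "off_poles p m t \<longleftrightarrow> t \<noteq> - p i \<and> t \<noteq> - p k" for t
  proof -
    have "p i + t = 0 \<longleftrightarrow> t = - p i" "p k + t = 0 \<longleftrightarrow> t = - p k" by auto
    moreover have "(\<forall>l. p l + t = 0 \<longrightarrow> m l = 0) \<longleftrightarrow> p i + t \<noteq> 0 \<and> p k + t \<noteq> 0"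
    proof
      assume "\<forall>l. p l + t = 0 \<longrightarrow> m l = 0"
      then show "p i + t \<noteq> 0 \<and> p k + t \<noteq> 0" using mi mk by (metis less_irrefl)
    next
      assume *: "p i + t \<noteq> 0 \<and> p k + t \<noteq> 0"
      show "\<forall>l. p l + t = 0 \<longrightarrow> m l = 0"
      proof (intro allI impI)
        fix l' assume "p l' + t = 0"
        then show "m l' = 0" using * l[of l'] nonneg[of l'] by (cases "m l' > 0") auto
      qed
    qed
    ultimately show ?thesis unfolding off_poles_def by simp
  qed
  have free: "\<And>l. m l > 0 \<Longrightarrow> - p l \<le> - p i \<or> - p k \<le> - p l" using l by force
  have c: "card ?A = 1" "card ?B = 1"
    by (intro card_pole_sum_roots_below[of m i p 1, OF nonneg mi]
        card_pole_sum_roots_above[of m k p 1, OF nonneg mk]; use l ord in force)+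
  then have f: "finite ?A" "finite ?B" using card_ge_0_finite by force+
  have G2: "card ?G = 2 \<and> finite ?G" if "- p i < s" "s < - p k" "pole_sum p m s < 1" for s
    using card_pole_sum_roots_gap(1)[of m i k p, OF nonneg mi mk free that] card_ge_0_finite by force
  have R: "card ?R = 2 + card ?G" if "finite ?G"
  proof -
    have "t \<in> ?R \<longleftrightarrow> t \<in> (?A \<union> ?B) \<union> ?G" for t
      using off[of t] ord by (cases "t < - p i"; cases "t = - p i"; cases "t < - p k"; cases "t = - p k") auto
    then have "?R = (?A \<union> ?B) \<union> ?G" by blast
    moreover have "?A \<inter> ?B = {}" using ord by auto
    then have "card (?A \<union> ?B) = 2" using f c by (simp add: card_Un_disjoint)
    moreover have "(?A \<union> ?B) \<inter> ?G = {}" by auto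
    ultimately show ?thesis using that f by (simp add: card_Un_disjoint)
  qed
  have ex: "(\<Sum>l\<in>UNIV. if m l = 0 \<and> pole_sum p m (- p l) < 1 then 2 else 0) =
     (if pole_sum p m (- p j) < 1 then 2 else (0::nat))"
    using dist mj mk mi by (subst univ) auto
  show ?thesis
  proof (cases "pole_sum p m (- p j) < 1")
    case True
    have "continuous_on {- p i<..<- p k} (pole_sum p m)"
    proof (rule continuous_on_pole_sum)
      fix l t assume "t \<in> {- p i<..<- p k}" "m l \<noteq> 0"
      then show "p l + t \<noteq> 0" using free[of l] nonneg[of l] by force
    qed
    then have "isCont (pole_sum p m) (- p j)"
      using ord by (simp add: continuous_on_eq_continuous_at)
    then have "eventually (\<lambda>t. pole_sum p m t < 1) (at (- p j))"
      using True by (simp add: isCont_def order_tendstoD(2))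
    then obtain d where d: "d > 0" "\<And>t. t \<noteq> - p j \<Longrightarrow> dist t (- p j) < d \<Longrightarrow> pole_sum p m t < 1"
      unfolding eventually_at by auto
    define e where "e = min (d/2) (min ((p i - p j)/2) ((p j - p k)/2))"
    have e: "e > 0" "e < d" "e < p i - p j" "e < p j - p k" using d(1) ord by (auto simp: e_def min_def)
    have "dips p m (- p i) (- p j)" unfolding dips_def
      using e by (intro exI[of _ "- p j - e"]) (auto intro!: d(2) simp: dist_real_def)
    moreover have "dips p m (- p j) (- p k)" unfolding dips_def
      using e by (intro exI[of _ "- p j + e"]) (auto intro!: d(2) simp: dist_real_def)
    ultimately show ?thesis unfolding full_count_def ex using True G2[of "- p j"] R ord by simp
  next
    case False
    have notboth: "\<not> (dips p m (- p i) (- p j) \<and> dips p m (- p j) (- p k))"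
    proof
      assume "dips p m (- p i) (- p j) \<and> dips p m (- p j) (- p k)"
      then obtain s s' where s: "- p i < s" "s < - p j" "pole_sum p m s < 1"
        "- p j < s'" "s' < - p k" "pole_sum p m s' < 1" unfolding dips_def by blast
      then have "pole_sum p m (- p j) < max (pole_sum p m s) (pole_sum p m s')"
        using pole_sum_quasiconvex_gap[of m i p "- p i" "- p k" s s', OF nonneg mi free] by auto
      then show False using False s by auto
    qed
    show ?thesis
    proof (cases "dips p m (- p i) (- p j) \<or> dips p m (- p j) (- p k)")
      case True
      then obtain s where "- p i < s" "s < - p k" "pole_sum p m s < 1"
        unfolding dips_def using ord by (meson less_trans neg_less_iff_less)
      then show ?thesis unfolding full_count_def ex using False G2[of s] R True notboth by auto
    next
      case nd: False
      then have "stays_above p m (- p i) (- p j)" "stays_above p m (- p j) (- p k)" using 1 2 by auto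
      then have "pole_sum p m t > 1" if "- p i < t" "t < - p k" for t
        using that off[of t] unfolding stays_above_def by (cases "t \<le> - p j") auto
      then have "?G = {}" by force
      then show ?thesis unfolding full_count_def ex using False nd R by (simp only: card.empty finite.emptyI) simp
    qed
  qed
qed

text \<open>The cases are: the middle pole active, both outer poles but not the middle one, a single
  outer pole. In each case pairs of feet at inactive poles make up for missing roots, so that the
  count depends on the dips alone.\<close>

theorem full_count_eq:
  fixes p m :: "'i::finite \<Rightarrow> real"
  assumes nonneg: "\<And>i. m i \<ge> 0" and nz: "\<exists>l. m l > 0"
    and univ: "UNIV = {i, j, k}" and ord: "p k < p j" "p j < p i"
    and 1: "dips p m (- p i) (- p j) \<or> stays_above p m (- p i) (- p j)"
    and 2: "dips p m (- p j) (- p k) \<or> stays_above p m (- p j) (- p k)"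
  shows "full_count p m = 2 + (if dips p m (- p i) (- p j) then 2 else 0)
     + (if dips p m (- p j) (- p k) then 2 else 0)"
proof -
  have l: "l = i \<or> l = j \<or> l = k" for l using univ by blast
  have oth: "p l \<le> p j" if "l \<noteq> i" for l using that l[of l] ord by auto
  have oth': "- p l \<le> - p j" if "l \<noteq> k" for l using that l[of l] ord by auto
  have univ': "UNIV = {k, j, i}" using univ by blast
  consider "m j > 0" | "m j = 0" "m i > 0" "m k > 0" | "m j = 0" "m i > 0" "m k = 0"
    | "m j = 0" "m i = 0" "m k > 0"
    using nz l nonneg by (metis less_le)
  then show ?thesis
  proof cases
    case mj: 1
    have "half_count p m i j = (if dips p m (- p i) (- p j) then 3 else 1)"
    proof (cases "dips p m (- p i) (- p j)")
      case True
      then show ?thesis unfolding dips_def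
        using half_count_inside[of m j p i, OF nonneg mj ord(2) oth] by auto
    next
      case False
      then show ?thesis using 1 half_count_outside[of m j p i, OF nonneg mj ord(2) oth]
        unfolding stays_above_def by auto
    qed
    moreover have "half_count (\<lambda>i. - p i) m k j = (if dips p m (- p j) (- p k) then 3 else 1)"
    proof -
      let ?p = "\<lambda>i. - p i"
      have o: "?p j < ?p k" using ord by simp
      have d: "dips ?p m (- ?p k) (- ?p j) = dips p m (- p j) (- p k)"
        "stays_above ?p m (- ?p k) (- ?p j) = stays_above p m (- p j) (- p k)"
        by (simp_all add: dips_minus stays_above_minus)
      show ?thesis
      proof (cases "dips p m (- p j) (- p k)")
        case True
        then have "dips ?p m (- ?p k) (- ?p j)" using d by blast
        then show ?thesis using True half_count_inside[of m j ?p k, OF nonneg mj o oth']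
          unfolding dips_def by auto
      next
        case False
        then have "stays_above ?p m (- ?p k) (- ?p j)" using 2 d by blast
        then show ?thesis using False half_count_outside[of m j ?p k, OF nonneg mj o oth']
          unfolding stays_above_def by auto
      qed
    qed
    ultimately show ?thesis using full_count_split[of m j i k p, OF nonneg mj univ ord] by simp
  next
    case 2
    then show ?thesis using full_count_outer_poles[of m i j k p] assms by blast
  next
    case 3
    then show ?thesis using full_count_one_pole[of m i j k p] assms by blast
  next
    case 4
    \<comment> \<open>Reflection exchanges \<open>i\<close> and \<open>k\<close> and makes the only
      active pole the leftmost one.\<close>
    have "full_count (\<lambda>i. - p i) m = 2 + (if dips (\<lambda>i. - p i) m (- (- p k)) (- (- p j)) then 2 else 0)
     + (if dips (\<lambda>i. - p i) m (- (- p j)) (- (- p i)) then 2 else 0)"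
      using 4 nonneg univ' ord assms(6,7)
      by (intro full_count_one_pole[of m k j i "\<lambda>i. - p i"]) (auto simp: dips_minus stays_above_minus)
    then show ?thesis by (simp add: full_count_minus dips_minus)
  qed
qed

lemma full_count_boundary:
  fixes p m :: "'i::finite \<Rightarrow> real"
  assumes pos: "\<And>i. m i > 0"
    and univ: "UNIV = {i, j, k}" and ord: "p k < p j" "p j < p i"
    and 1: "\<not> dips p m (- p i) (- p j)" "- p i < s" "s < - p j" "pole_sum p m s = 1"
    and 2: "dips p m (- p j) (- p k) \<or> stays_above p m (- p j) (- p k)"
  shows "full_count p m \<in> {3, 5}"
proof -
  let ?p = "\<lambda>i. - p i"
  have nonneg: "m i \<ge> 0" for i using pos[of i] by simp
  have l: "l = i \<or> l = j \<or> l = k" for l using univ by blast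
  have oth: "p l \<le> p j" if "l \<noteq> i" for l using that l[of l] ord by auto
  have oth': "- p l \<le> - p j" if "l \<noteq> k" for l using that l[of l] ord by auto
  have ge: "pole_sum p m s \<ge> 1" if "- p i < s" "s < - p j" for s
    using 1(1) that not_less unfolding dips_def by blast
  have "half_count p m i j = 2"
    by (rule half_count_boundary[of m j p i, OF nonneg pos ord(2) oth pos ge 1(2-)])
  moreover have "half_count ?p m k j \<in> {1, 3}"
  proof -
    have o: "?p j < ?p k" using ord by simp
    have "dips ?p m (- ?p k) (- ?p j) \<or> stays_above ?p m (- ?p k) (- ?p j)"
      using 2 by (simp add: dips_minus stays_above_minus)
    then show ?thesis
    proof
      assume "dips ?p m (- ?p k) (- ?p j)"
      then show ?thesis using half_count_inside[of m j ?p k, OF nonneg pos o oth']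
        unfolding dips_def by auto
    next
      assume "stays_above ?p m (- ?p k) (- ?p j)"
      then show ?thesis using half_count_outside[of m j ?p k, OF nonneg pos o oth']
        unfolding stays_above_def by auto
    qed
  qed
  ultimately show ?thesis using full_count_split[of m j i k p, OF nonneg pos univ ord] by auto
qed

section \<open>Feet of the normals\<close>

lemma card_nonzero_square_roots:
  fixes c :: real
  shows "card {x. x \<noteq> 0 \<and> x^2 = c} = (if c > 0 then 2 else 0)"
    and "finite {x. x \<noteq> 0 \<and> x^2 = c}"
proof -
  have *: "{x. x \<noteq> 0 \<and> x^2 = c} = (if c > 0 then {sqrt c, - sqrt c} else {})"
  proof (cases "c > 0")
    case True
    then show ?thesis by (auto simp: power2_eq_iff[of _ "sqrt c", symmetric])
  next
    case False
    then have "\<not> (x \<noteq> 0 \<and> x^2 = c)" for x using zero_less_power2[of x] by auto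
    then show ?thesis using False by simp
  qed
  show "card {x. x \<noteq> 0 \<and> x^2 = c} = (if c > 0 then 2 else 0)" "finite {x. x \<noteq> 0 \<and> x^2 = c}"
    unfolding * by (auto simp: card_insert_if)
qed

text \<open>\<open>al\<close> holds the squared semi-axes and \<open>shift t P\<close> is \<open>P + t N(P)\<close> with the unnormalised normal N.\<close>

locale ellipsoid =
  fixes al :: "3 \<Rightarrow> real"
  assumes al3: "0 < al 3" and al32: "al 3 < al 2" and al21: "al 2 < al 1"
begin

text \<open>Besides having the ellipsoid as its level set 1, \<open>Q\<close> on unit tangent
  vectors is the second fundamental form up to the length of the normal.\<close>

definition Q :: "real^3 \<Rightarrow> real" where
  "Q P = (\<Sum>i\<in>UNIV. (P$i)^2 / al i)"

definition shift :: "real \<Rightarrow> real^3 \<Rightarrow> real^3" where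
  "shift t P = (\<chi> i. P$i * (1 + t / al i))"

definition mass :: "real^3 \<Rightarrow> 3 \<Rightarrow> real" where
  "mass A i = al i * (A$i)^2"

text \<open>The solution of \<open>A = shift t B\<close> for \<open>B\<close>. Where
  \<open>al i + t = 0\<close>, division by zero makes the coordinate 0, which is the wanted choice
  when \<open>A$i = 0\<close>.\<close>

definition foot :: "real^3 \<Rightarrow> real \<Rightarrow> real^3" where
  "foot A t = (\<chi> i. al i * A$i / (al i + t))"

lemma al_pos: "al i > 0"
  using exhaust_3[of i] al3 al32 al21 by auto

lemma al_inj: "al i = al j \<Longrightarrow> i = j"
  using exhaust_3[of i] exhaust_3[of j] al32 al21 by auto

lemma mass_nonneg: "mass A i \<ge> 0"
  unfolding mass_def using al_pos[of i] by simp

lemma mass_eq_0_iff: "mass A i = 0 \<longleftrightarrow> A$i = 0"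
  unfolding mass_def using al_pos[of i] by simp

lemma mass_pos: "A$i \<noteq> 0 \<Longrightarrow> mass A i > 0"
  using mass_nonneg[of A i] mass_eq_0_iff[of A i] by simp

lemma eq_shift_iff: "A = shift t B \<longleftrightarrow> (\<forall>i. al i * A$i = B$i * (al i + t))"
proof -
  have "A$i = B$i * (1 + t / al i) \<longleftrightarrow> al i * A$i = B$i * (al i + t)" for i
    using al_pos[of i] by (simp add: field_simps)
  then show ?thesis unfolding shift_def vec_eq_iff by simp
qed

lemma Q_foot: "Q (foot A t) = pole_sum al (mass A) t"
  unfolding Q_def foot_def pole_sum_def mass_def
proof (rule sum.cong)
  fix i :: 3
  show "((\<chi> i. al i * A$i / (al i + t)) $ i)^2 / al i = al i * (A$i)^2 / (al i + t)^2"
    using al_pos[of i] by (simp add: power_divide power_mult_distrib power2_eq_square)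
qed simp

lemma shift_foot: "off_poles al (mass A) t \<Longrightarrow> A = shift t (foot A t)"
  unfolding eq_shift_iff foot_def off_poles_def by (auto simp: mass_eq_0_iff)

definition feet :: "real^3 \<Rightarrow> (real^3) set" where
  "feet A = {B. Q B = 1 \<and> (\<exists>t. A = shift t B)}"

text \<open>Regular feet vanish wherever \<open>A\<close> does, so the parameter determines the
  foot; conversely a nonzero coordinate of \<open>A\<close> lets the foot determine the parameter.
  Thus \<open>foot A\<close> is a bijection from the roots.\<close>

lemma card_regular_feet:
  assumes "A \<noteq> 0"
  shows "card {B \<in> feet A. \<forall>j. A$j = 0 \<longrightarrow> B$j = 0}
    = card {t. off_poles al (mass A) t \<and> pole_sum al (mass A) t = 1}"
    and "finite {B \<in> feet A. \<forall>j. A$j = 0 \<longrightarrow> B$j = 0}"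
proof -
  let ?R = "{t. off_poles al (mass A) t \<and> pole_sum al (mass A) t = 1}"
  let ?M = "{B \<in> feet A. \<forall>j. A$j = 0 \<longrightarrow> B$j = 0}"
  obtain i where i: "A$i \<noteq> 0" using assms by (auto simp: vec_eq_iff)
  have "inj_on (foot A) ?R"
  proof (rule inj_onI)
    fix s t assume *: "s \<in> ?R" "t \<in> ?R" "foot A s = foot A t"
    have "al i + s \<noteq> 0" "al i + t \<noteq> 0" using * i unfolding off_poles_def by (auto simp: mass_eq_0_iff)
    moreover have "al i * A$i / (al i + s) = al i * A$i / (al i + t)"
      using *(3) unfolding foot_def vec_eq_iff by simp
    ultimately show "s = t" using i al_pos[of i] by (simp add: frac_eq_eq)
  qed
  moreover have "?M = foot A ` ?R"
  proof (intro set_eqI iffI)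
    fix B assume B: "B \<in> ?M"
    then obtain t where t: "A = shift t B" unfolding feet_def by auto
    then have e: "\<And>i. al i * A$i = B$i * (al i + t)" unfolding eq_shift_iff by blast
    have off: "off_poles al (mass A) t" unfolding off_poles_def mass_eq_0_iff
      using e al_pos by (metis less_irrefl mult_eq_0_iff)
    have "B$i = al i * A$i / (al i + t)" for i
    proof (cases "al i + t = 0")
      case True
      then have "A$i = 0" using off unfolding off_poles_def mass_eq_0_iff by blast
      then show ?thesis using B by simp
    next
      case False
      then show ?thesis using e[of i] by (simp add: field_simps)
    qed
    then have Bf: "B = foot A t" unfolding foot_def vec_eq_iff by simp
    then have "pole_sum al (mass A) t = 1" using B Q_foot unfolding feet_def by auto
    then show "B \<in> foot A ` ?R" using Bf off by blast
  next
    fix B assume "B \<in> foot A ` ?R"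
    then obtain t where t: "t \<in> ?R" "B = foot A t" by blast
    then have "Q B = 1" "A = shift t B" using Q_foot[of A t] shift_foot[of A t] by auto
    then have "B \<in> feet A" unfolding feet_def by blast
    then show "B \<in> ?M" using t by (auto simp: foot_def)
  qed
  moreover have "finite ?R"
    by (rule finite_pole_sum_roots[of "mass A" i, OF mass_nonneg mass_pos[of A i, OF i]])
  ultimately show "card ?M = card ?R" "finite ?M" by (simp_all add: card_image)
qed

text \<open>If \<open>A$j = 0\<close> and \<open>B$j\<close> is nonzero then
  \<open>t = - al j\<close>. The other coordinates of \<open>B\<close> are then fixed, the
  \<open>al i\<close> being distinct, and \<open>Q B = 1\<close> prescribes
  \<open>(B$j)^2\<close>.\<close>

lemma card_singular_feet:
  shows "card {B \<in> feet A. A$j = 0 \<and> B$j \<noteq> 0}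
    = (if mass A j = 0 \<and> pole_sum al (mass A) (- al j) < 1 then 2 else 0)" (is ?card)
    and "finite {B \<in> feet A. A$j = 0 \<and> B$j \<noteq> 0}" (is ?finite)
proof -
  have "?card \<and> ?finite"
  proof (cases "A$j = 0")
    case False
    then show ?thesis by (simp add: mass_eq_0_iff)
  next
    case True
    let ?M = "{B \<in> feet A. A$j = 0 \<and> B$j \<noteq> 0}"
    define f where "f = foot A (- al j)"
    define g where "g x = (\<chi> i. if i = j then x else f$i)" for x :: real
    define c where "c = al j * (1 - pole_sum al (mass A) (- al j))"
    have fj: "f$j = 0" unfolding f_def foot_def by simp
    have Qg: "Q (g x) = x^2 / al j + pole_sum al (mass A) (- al j)" for x
    proof -
      have "Q (g x) = (\<Sum>i\<in>UNIV. (if i = j then x^2 / al j else 0) + (f$i)^2 / al i)"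
        unfolding Q_def g_def by (rule sum.cong) (auto simp: fj)
      also have "\<dots> = x^2 / al j + Q f" by (simp add: sum.distrib Q_def)
      finally show ?thesis unfolding f_def Q_foot .
    qed
    have Q1: "Q (g x) = 1 \<longleftrightarrow> x^2 = c" for x
      unfolding Qg c_def using al_pos[of j] by (auto simp: field_simps)
    have ne: "al i + - al j \<noteq> 0" if "i \<noteq> j" for i using al_inj[of i j] that by auto
    have M: "?M = g ` {x. x \<noteq> 0 \<and> x^2 = c}"
    proof (intro set_eqI iffI)
      fix B assume B: "B \<in> ?M"
      then obtain t where t: "A = shift t B" unfolding feet_def by auto
      then have e: "\<And>i. al i * A$i = B$i * (al i + t)" unfolding eq_shift_iff by blast
      then have "t = - al j" using B e[of j] by auto
      have "B$i = f$i" if "i \<noteq> j" for i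
        using e[of i] ne[OF that] unfolding f_def foot_def \<open>t = - al j\<close> by (simp add: field_simps)
      then have Bg: "B = g (B$j)" unfolding g_def vec_eq_iff by simp
      moreover have "(B$j)^2 = c" using B Q1[of "B$j"] Bg unfolding feet_def by simp
      ultimately show "B \<in> g ` {x. x \<noteq> 0 \<and> x^2 = c}" using B by blast
    next
      fix B assume "B \<in> g ` {x. x \<noteq> 0 \<and> x^2 = c}"
      then obtain x where x: "B = g x" "x \<noteq> 0" "x^2 = c" by blast
      have "al i * A$i = g x $ i * (al i + - al j)" for i
        using ne[of i] True unfolding g_def f_def foot_def by simp
      then have "A = shift (- al j) (g x)" unfolding eq_shift_iff by blast
      then show "B \<in> ?M" unfolding feet_def using x Q1[of x] True by (auto simp: g_def)
    qed
    then have "?finite" by (simp add: card_nonzero_square_roots(2))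
    have "x = y" if "g x = g y" for x y
      using that unfolding g_def vec_eq_iff by (auto dest: spec[of _ j])
    then have "inj_on g {x. x \<noteq> 0 \<and> x^2 = c}" by (rule inj_onI)
    then have "card ?M = card {x. x \<noteq> 0 \<and> x^2 = c}"
      unfolding M by (rule card_image)
    also have "\<dots> = (if c > 0 then 2 else 0)" by (rule card_nonzero_square_roots(1))
    also have "c > 0 \<longleftrightarrow> pole_sum al (mass A) (- al j) < 1"
      unfolding c_def using al_pos[of j] by (simp add: zero_less_mult_iff)
    finally have ?card using True by (simp add: mass_eq_0_iff)
    then show ?thesis using \<open>?finite\<close> by blast
  qed
  then show ?card ?finite by blast+
qed

text \<open>A foot singular in two coordinates \<open>i\<close> and \<open>j\<close> would need both
  \<open>t = - al i\<close> and \<open>t = - al j\<close>, so the classes of singular feet are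
  disjoint and the counts add.\<close>

lemma card_feet:
  assumes "A \<noteq> 0"
  shows "card (feet A) = full_count al (mass A)"
proof -
  let ?M = "{B \<in> feet A. \<forall>j. A$j = 0 \<longrightarrow> B$j = 0}"
  let ?N = "\<lambda>j. {B \<in> feet A. A$j = 0 \<and> B$j \<noteq> 0}"
  have disj: "?N i \<inter> ?N j = {}" if "i \<noteq> j" for i j
  proof -
    have False if B: "B \<in> ?N i" "B \<in> ?N j" for B
    proof -
      obtain t where "A = shift t B" using B unfolding feet_def by auto
      then have "\<And>i. al i * A$i = B$i * (al i + t)" unfolding eq_shift_iff by blast
      from this[of i] this[of j] have "al i = al j" using B by auto
      then show False using al_inj \<open>i \<noteq> j\<close> by blast
    qed
    then show ?thesis by blast
  qed
  have "card (\<Union>j\<in>UNIV. ?N j) = (\<Sum>j\<in>UNIV. card (?N j))"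
    using card_singular_feet(2) disj by (intro card_UN_disjoint) auto
  moreover have "feet A = ?M \<union> (\<Union>j\<in>UNIV. ?N j)" by blast
  moreover have "?M \<inter> (\<Union>j\<in>UNIV. ?N j) = {}" by blast
  ultimately have "card (feet A) = card ?M + (\<Sum>j\<in>UNIV. card (?N j))"
    using card_Un_disjoint[of ?M "\<Union>j\<in>UNIV. ?N j"] card_regular_feet(2)[OF assms] card_singular_feet(2)
    by (simp only: finite_UN finite_class.finite_UNIV) auto
  then show ?thesis unfolding full_count_def card_regular_feet(1)[OF assms] card_singular_feet(1) .
qed

end

section \<open>The sheets as boundaries of star-shaped regions\<close>

context ellipsoid
begin

text \<open>The points whose pole sum is at most 1 somewhere on the closed gap off the active poles,
  written as an image of a compact set so that the end poles need no limits.\<close>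

definition solid :: "real \<Rightarrow> real \<Rightarrow> (real^3) set" where
  "solid l u = {shift t P | t P. l \<le> t \<and> t \<le> u \<and> Q P \<le> 1}"

definition core :: "real \<Rightarrow> real \<Rightarrow> (real^3) set" where
  "core l u = {A. dips al (mass A) l u}"

text \<open>Away from the poles, \<open>slope P t\<close> is minus half the derivative at
  \<open>t\<close> of the pole sum of \<open>A = shift t P\<close>; in the coordinates of
  \<open>A\<close> it is the left side of the second equation of the caustic.\<close>

definition slope :: "real^3 \<Rightarrow> real \<Rightarrow> real" where
  "slope P s = (\<Sum>i\<in>UNIV. (P$i)^2 / al i / (al i + s))"

text \<open>Marks \<open>t\<close> as a sign change of \<open>slope P\<close>, which is decreasing
  on a gap. Signs on both sides, instead of \<open>slope P t = 0\<close>, also admit an end of the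
  gap.\<close>

definition critical :: "real \<Rightarrow> real \<Rightarrow> real^3 \<Rightarrow> real \<Rightarrow> bool" where
  "critical l u P t \<longleftrightarrow> l \<le> t \<and> t \<le> u \<and>
     (\<forall>s. l < s \<and> s < u \<longrightarrow> (s < t \<longrightarrow> slope P s \<ge> 0) \<and> (t < s \<longrightarrow> slope P s \<le> 0))"

definition sheet :: "real \<Rightarrow> real \<Rightarrow> (real^3) set" where
  "sheet l u = {shift t P | t P. Q P = 1 \<and> critical l u P t}"

definition gap :: "real \<Rightarrow> real \<Rightarrow> bool" where
  "gap l u \<longleftrightarrow> l < u \<and> (\<forall>i. al i \<le> - u \<or> - l \<le> al i)"

lemma solidI: "l \<le> t \<Longrightarrow> t \<le> u \<Longrightarrow> Q P \<le> 1 \<Longrightarrow> shift t P \<in> solid l u"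
  unfolding solid_def by blast

lemma gap12: "gap (- al 1) (- al 2)" and gap23: "gap (- al 2) (- al 3)"
  unfolding gap_def forall_3 using al32 al21 by auto

lemma gap_nz: "gap l u \<Longrightarrow> l < s \<Longrightarrow> s < u \<Longrightarrow> al i + s \<noteq> 0"
  unfolding gap_def by (smt (verit))

lemma gap_off_poles: "gap l u \<Longrightarrow> l < s \<Longrightarrow> s < u \<Longrightarrow> off_poles al m s"
  unfolding off_poles_def using gap_nz by blast

lemma Q_nonneg: "Q P \<ge> 0"
  unfolding Q_def using al_pos by (intro sum_nonneg) (simp add: less_imp_le)

lemma continuous_on_Q: "continuous_on S Q"
  unfolding Q_def using al_pos by (intro continuous_intros) (simp add: less_imp_neq[symmetric])

lemma compact_Q_ball: "compact {P. Q P \<le> 1}"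
proof -
  have "closed {P. Q P \<le> 1}" by (intro closed_Collect_le continuous_on_Q continuous_intros)
  moreover have "bounded {P. Q P \<le> 1}"
  proof (rule boundedI)
    fix P assume P: "P \<in> {P. Q P \<le> 1}"
    have "\<bar>P$i\<bar> \<le> sqrt (al i)" for i
    proof -
      have "(P$i)^2 / al i \<le> Q P" unfolding Q_def
        using al_pos by (intro member_le_sum) (auto simp: less_imp_le)
      then have "(P$i)^2 / al i \<le> 1" using P by simp
      then have "(P$i)^2 \<le> al i" using al_pos[of i] by (simp add: field_simps)
      then show ?thesis by (metis real_sqrt_abs real_sqrt_le_mono)
    qed
    then have "(\<Sum>i\<in>UNIV. \<bar>P$i\<bar>) \<le> (\<Sum>i\<in>UNIV. sqrt (al i))" by (intro sum_mono)
    then show "norm P \<le> (\<Sum>i\<in>UNIV. sqrt (al i))" using norm_le_l1_cart[of P] by linarith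
  qed
  ultimately show ?thesis by (simp add: compact_eq_bounded_closed)
qed

lemma compact_solid: "compact (solid l u)"
proof -
  have "solid l u = (\<lambda>(t, P). shift t P) ` ({l..u} \<times> {P. Q P \<le> 1})"
    unfolding solid_def by force
  moreover have "continuous_on ({l..u} \<times> {P. Q P \<le> 1}) (\<lambda>(t, P). shift t P)"
    unfolding shift_def case_prod_beta using al_pos
    by (intro continuous_intros) (simp add: less_imp_neq[symmetric])
  ultimately show ?thesis using compact_Q_ball
    by (simp add: compact_Times compact_continuous_image)
qed

lemma open_core: "open (core l u)"
proof -
  have "core l u = (\<Union>s\<in>{l<..<u}. {A. pole_sum al (mass A) s < 1})"
    unfolding core_def dips_def by auto
  moreover have "open {A. pole_sum al (mass A) s < 1}" for s
    unfolding pole_sum_def mass_def divide_inverse by (intro open_Collect_less continuous_intros)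
  ultimately show ?thesis by auto
qed

lemma core_subset_solid:
  assumes "gap l u"
  shows "core l u \<subseteq> solid l u"
proof
  fix A assume "A \<in> core l u"
  then obtain s where s: "l < s" "s < u" "pole_sum al (mass A) s < 1"
    unfolding core_def dips_def by auto
  have "A = shift s (foot A s)" using shift_foot gap_off_poles[OF assms s(1,2)] by blast
  moreover have "Q (foot A s) \<le> 1" using s by (simp add: Q_foot)
  ultimately show "A \<in> solid l u" unfolding solid_def using s by (auto intro: less_imp_le)
qed

lemma solid_starlike:
  assumes "A \<in> solid l u" "0 \<le> c" "c \<le> 1"
  shows "c *\<^sub>R A \<in> solid l u"
proof -
  obtain t P where tP: "A = shift t P" "l \<le> t" "t \<le> u" "Q P \<le> 1"
    using assms(1) unfolding solid_def by auto
  have "c *\<^sub>R A = shift t (c *\<^sub>R P)" unfolding tP(1) shift_def vec_eq_iff by simp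
  moreover have "Q (c *\<^sub>R P) = c^2 * Q P"
    unfolding Q_def by (simp add: power_mult_distrib sum_distrib_left)
  moreover have "c^2 * Q P \<le> 1"
    using tP(4) assms Q_nonneg[of P] by (simp add: mult_le_one power_le_one)
  ultimately show ?thesis using tP solidI by simp
qed

lemma not_solid_stays_above:
  assumes "A \<notin> solid l u"
  shows "stays_above al (mass A) l u"
  unfolding stays_above_def
proof (intro allI impI, elim conjE)
  fix s assume s: "l \<le> s" "s \<le> u" "off_poles al (mass A) s"
  show "pole_sum al (mass A) s > 1"
  proof (rule ccontr)
    assume "\<not> pole_sum al (mass A) s > 1"
    then have "Q (foot A s) \<le> 1" by (simp add: Q_foot)
    then show False using assms s shift_foot[OF s(3)] unfolding solid_def by blast
  qed
qed

section \<open>Sheets as the boundary between core and solid\<close>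

lemma pole_sum_shift:
  assumes "\<And>i. al i + s \<noteq> 0"
  shows "pole_sum al (mass (shift t P)) s = (\<Sum>i\<in>UNIV. (P$i)^2 / al i * ((al i + t) / (al i + s))^2)"
  unfolding pole_sum_def
proof (rule sum.cong)
  fix i :: 3
  have "1 + t / al i = (al i + t) / al i" using al_pos[of i] by (simp add: field_simps)
  then have "mass (shift t P) i = (P$i)^2 / al i * (al i + t)^2"
    unfolding mass_def shift_def using al_pos[of i]
    by (simp add: power_mult_distrib power_divide power2_eq_square)
  then show "mass (shift t P) i / (al i + s)^2 = (P$i)^2 / al i * ((al i + t) / (al i + s))^2"
    by (simp add: power_divide)
qed simp

text \<open>Applying \<open>1 + 2 * z \<le> (1 + z)^2\<close> to each term bounds the pole sum at
  \<open>s\<close> below by \<open>Q P + 2 * ((t - s) * slope P s)\<close>, which is at least 1 by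
  criticality. No limit at \<open>t\<close> is taken, so the ends of the gap are covered.\<close>

lemma sheet_disjoint_core:
  assumes "gap l u" "Q P = 1" "critical l u P t"
  shows "shift t P \<notin> core l u"
proof
  assume "shift t P \<in> core l u"
  then obtain s where s: "l < s" "s < u" "pole_sum al (mass (shift t P)) s < 1"
    unfolding core_def dips_def by auto
  have nz: "al i + s \<noteq> 0" for i using gap_nz[OF assms(1) s(1,2)] .
  have "(\<Sum>i\<in>UNIV. (P$i)^2 / al i + 2 * (t - s) * ((P$i)^2 / al i / (al i + s)))
      \<le> (\<Sum>i\<in>UNIV. (P$i)^2 / al i * ((al i + t) / (al i + s))^2)"
  proof (rule sum_mono)
    fix i :: 3
    define z where "z = (t - s) / (al i + s)"
    have "(al i + t) / (al i + s) = 1 + z" unfolding z_def using nz[of i] by (simp add: field_simps)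
    moreover have "1 + 2 * z \<le> (1 + z)^2" by (simp add: power2_eq_square algebra_simps)
    then have "(P$i)^2 / al i * (1 + 2 * z) \<le> (P$i)^2 / al i * (1 + z)^2"
      using al_pos[of i] by (intro mult_left_mono) auto
    moreover have "(P$i)^2 / al i + 2 * (t - s) * ((P$i)^2 / al i / (al i + s)) = (P$i)^2 / al i * (1 + 2 * z)"
      unfolding z_def by (simp add: distrib_left)
    ultimately show "(P$i)^2 / al i + 2 * (t - s) * ((P$i)^2 / al i / (al i + s))
      \<le> (P$i)^2 / al i * ((al i + t) / (al i + s))^2" by simp
  qed
  also have "\<dots> < 1" using s(3) pole_sum_shift[OF nz] by simp
  also have "(\<Sum>i\<in>UNIV. (P$i)^2 / al i + 2 * (t - s) * ((P$i)^2 / al i / (al i + s)))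
      = Q P + 2 * ((t - s) * slope P s)"
    unfolding Q_def slope_def by (simp only: sum.distrib sum_distrib_left mult.assoc)
  finally have "(t - s) * slope P s < 0" using assms(2) by simp
  moreover have "(s < t \<longrightarrow> slope P s \<ge> 0) \<and> (t < s \<longrightarrow> slope P s \<le> 0)"
    using assms(3) s unfolding critical_def by blast
  ultimately show False by (auto simp: mult_less_0_iff)
qed

text \<open>Outside the core the pole sum is at least 1 on the gap. Its limit at \<open>t\<close>
  forces \<open>Q P = 1\<close> and makes the coordinates of \<open>P\<close> with pole at
  \<open>t\<close> vanish; the first-order term at \<open>t\<close> then gives the sign of the
  slope, and monotonicity carries it along the gap.\<close>

lemma solid_diff_core_critical:
  assumes g: "gap l u" and t: "l \<le> t" "t \<le> u" and Q: "Q P \<le> 1" and nc: "shift t P \<notin> core l u"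
  shows "Q P = 1 \<and> critical l u P t"
proof -
  define w where "w i = (P$i)^2 / al i" for i
  have w0: "w i \<ge> 0" for i unfolding w_def using al_pos[of i] by simp
  have Qw: "Q P = (\<Sum>i\<in>UNIV. w i)" unfolding Q_def w_def ..
  have slw: "slope P s = (\<Sum>i\<in>UNIV. w i / (al i + s))" for s unfolding slope_def w_def ..
  have nz: "al i + s \<noteq> 0" if "l < s" "s < u" for s i using gap_nz[OF g that] .
  have ge: "(\<Sum>i\<in>UNIV. w i * ((al i + t) / (al i + s))^2) \<ge> 1" if "l < s" "s < u" for s
    using nc that pole_sum_shift[OF nz[OF that]] unfolding core_def dips_def w_def by force
  \<comment> \<open>A term with \<open>al i + t = 0\<close> is identically 0, so the limit loses its
    weight \<open>w i\<close>; comparison with \<open>Q P\<close> then shows this loss to be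
    zero.\<close>
  have lim: "((\<lambda>s. \<Sum>i\<in>UNIV. w i * ((al i + t) / (al i + s))^2) \<longlongrightarrow>
      (\<Sum>i\<in>UNIV. if al i + t = 0 then 0 else w i)) (at t within {l<..<u})"
  proof (rule tendsto_sum)
    fix i :: 3
    show "((\<lambda>s. w i * ((al i + t) / (al i + s))^2) \<longlongrightarrow> (if al i + t = 0 then 0 else w i)) (at t within {l<..<u})"
    proof (cases "al i + t = 0")
      case False
      then show ?thesis by (auto intro!: tendsto_eq_intros)
    qed simp
  qed
  have "l < u" using g unfolding gap_def by simp
  then have "t islimpt closure {l<..<u}"
    using t by (intro islimpt_closure_open[of "{l<..<u}"]) auto
  then have nb: "at t within {l<..<u} \<noteq> bot" by (simp add: limpt_of_closure trivial_limit_within)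
  have "(\<Sum>i\<in>UNIV. if al i + t = 0 then 0 else w i) \<ge> 1"
    using ge by (intro tendsto_lowerbound[OF lim _ nb]) (auto simp: eventually_at_filter)
  moreover have le: "(if al i + t = 0 then 0 else w i) \<le> w i" for i using w0 by simp
  then have "(\<Sum>i\<in>UNIV. if al i + t = 0 then 0 else w i) \<le> (\<Sum>i\<in>UNIV. w i)" by (rule sum_mono)
  ultimately have Q1: "Q P = 1" and "(\<Sum>i\<in>UNIV. if al i + t = 0 then 0 else w i) = (\<Sum>i\<in>UNIV. w i)"
    using Q Qw by linarith+
  then have "(\<Sum>i\<in>UNIV. w i - (if al i + t = 0 then 0 else w i)) = 0" by (simp add: sum_subtractf)
  then have wz': "\<forall>i\<in>UNIV. w i - (if al i + t = 0 then 0 else w i) = 0"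
    using le by (subst (asm) sum_nonneg_eq_0_iff) auto
  have wz: "w i = 0" if "al i + t = 0" for i using bspec[OF wz', of i] that by simp
  \<comment> \<open>The excess of the pole sum over 1, with the factor \<open>t - s\<close> split
    off by the difference of squares; the remaining factor tends to twice the slope at
    \<open>t\<close>.\<close>
  have diff: "(t - s) * (\<Sum>i\<in>UNIV. w i * (2 * al i + t + s) / (al i + s)^2) \<ge> 0" if s: "l < s" "s < u" for s
  proof -
    have "w i * ((al i + t) / (al i + s))^2 = w i + (t - s) * (w i * (2 * al i + t + s) / (al i + s)^2)" for i
    proof -
      have *: "v * ((x^2 + d * e) / x^2) = v + d * (v * e / x^2)" if "x \<noteq> 0" for v x d e :: real
        using that by (simp add: field_simps)
      have "(al i + t)^2 = (al i + s)^2 + (t - s) * (2 * al i + t + s)" by algebra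
      then show ?thesis using *[OF nz[OF s]] by (simp only: power_divide)
    qed
    then show ?thesis using ge[OF s] Q1 Qw by (simp add: sum.distrib sum_distrib_left)
  qed
  have lim2: "((\<lambda>s. \<Sum>i\<in>UNIV. w i * (2 * al i + t + s) / (al i + s)^2) \<longlongrightarrow>
      (\<Sum>i\<in>UNIV. 2 * (w i / (al i + t)))) (at t within S)" for S
  proof (rule tendsto_sum)
    fix i :: 3
    show "((\<lambda>s. w i * (2 * al i + t + s) / (al i + s)^2) \<longlongrightarrow> 2 * (w i / (al i + t))) (at t within S)"
    proof (cases "al i + t = 0")
      case False
      have "w i * (2 * al i + t + t) / (al i + t)^2 = 2 * (w i / (al i + t))"
      proof -
        have *: "v * (2 * x) / x^2 = 2 * (v / x)" if "x \<noteq> 0" for v x :: real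
          using that by (simp add: power2_eq_square)
        have "2 * al i + t + t = 2 * (al i + t)" by simp
        then show ?thesis using *[OF False] by metis
      qed
      moreover have "((\<lambda>s. w i * (2 * al i + t + s) / (al i + s)^2) \<longlongrightarrow>
          w i * (2 * al i + t + t) / (al i + t)^2) (at t within S)"
        using False by (intro tendsto_intros) auto
      ultimately show ?thesis by simp
    qed (simp add: wz)
  qed
  have same: "al i + s > 0 \<longleftrightarrow> al i + t > 0" if "l < s" "s < u" "al i + t \<noteq> 0" for i s
    using g that t unfolding gap_def by (smt (verit))
  \<comment> \<open>One of the two points is \<open>t\<close>, which may be a pole; the comparison
    survives there because \<open>w i = 0\<close>.\<close>
  have mono: "w i / (al i + y) \<le> w i / (al i + x)"
    if "x < y" "x = t \<and> l < y \<and> y < u \<or> y = t \<and> l < x \<and> x < u" for x y i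
  proof (cases "al i + t = 0")
    case False
    then have "(al i + x) * (al i + y) > 0"
      using that same[of x i] same[of y i] nz[of x i] nz[of y i] by (auto simp: zero_less_mult_iff)
    then show ?thesis using that(1) w0[of i]
      by (intro divide_left_mono) (auto simp: mult.commute)
  qed (simp add: wz)
  have "slope P s \<ge> 0" if s: "l < s" "s < u" "s < t" for s
  proof -
    \<comment> \<open>Left of \<open>t\<close> the factor \<open>t - r\<close> is positive and can
      be divided out before passing to the limit.\<close>
    have "eventually (\<lambda>r. (\<Sum>i\<in>UNIV. w i * (2 * al i + t + r) / (al i + r)^2) \<ge> 0) (at_left t)"
      unfolding eventually_at_left_field
    proof (intro exI conjI allI impI)
      fix r assume r: "s < r" "r < t"
      then show "(\<Sum>i\<in>UNIV. w i * (2 * al i + t + r) / (al i + r)^2) \<ge> 0"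
        using diff[of r] s t by (simp add: zero_le_mult_iff)
    qed (rule s)
    then have "(\<Sum>i\<in>UNIV. 2 * (w i / (al i + t))) \<ge> 0"
      by (rule tendsto_lowerbound[OF lim2]) simp
    then have "0 \<le> (\<Sum>i\<in>UNIV. w i / (al i + t))"
      unfolding sum_distrib_left[symmetric] by simp
    also have "\<dots> \<le> slope P s" unfolding slw using s by (intro sum_mono mono) auto
    finally show ?thesis .
  qed
  moreover have "slope P s \<le> 0" if s: "l < s" "s < u" "t < s" for s
  proof -
    have "eventually (\<lambda>r. (\<Sum>i\<in>UNIV. w i * (2 * al i + t + r) / (al i + r)^2) \<le> 0) (at_right t)"
      unfolding eventually_at_right_field
    proof (intro exI conjI allI impI)
      fix r assume r: "t < r" "r < s"
      then show "(\<Sum>i\<in>UNIV. w i * (2 * al i + t + r) / (al i + r)^2) \<le> 0"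
        using diff[of r] s t by (simp add: zero_le_mult_iff)
    qed (rule s)
    then have "(\<Sum>i\<in>UNIV. 2 * (w i / (al i + t))) \<le> 0"
      by (rule tendsto_upperbound[OF lim2]) simp
    then have "0 \<ge> (\<Sum>i\<in>UNIV. w i / (al i + t))"
      unfolding sum_distrib_left[symmetric] by simp
    moreover have "slope P s \<le> (\<Sum>i\<in>UNIV. w i / (al i + t))"
      unfolding slw using s by (intro sum_mono mono) auto
    ultimately show ?thesis by linarith
  qed
  ultimately show ?thesis using Q1 t unfolding critical_def by blast
qed

lemma sheet_eq:
  assumes "gap l u"
  shows "sheet l u = solid l u - core l u"
proof (intro set_eqI iffI)
  fix A assume "A \<in> sheet l u"
  then obtain t P where tP: "A = shift t P" "Q P = 1" "critical l u P t" unfolding sheet_def by auto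
  then have "A \<in> solid l u" unfolding critical_def by (simp add: solidI)
  then show "A \<in> solid l u - core l u" using sheet_disjoint_core[OF assms tP(2,3)] tP(1) by simp
next
  fix A assume A: "A \<in> solid l u - core l u"
  then obtain t P where tP: "A = shift t P" "l \<le> t" "t \<le> u" "Q P \<le> 1" unfolding solid_def by auto
  then show "A \<in> sheet l u"
    using solid_diff_core_critical[OF assms tP(2-4)] A unfolding sheet_def by blast
qed

lemma inside_sheet:
  assumes "gap l u"
  shows "inside (sheet l u) = core l u"
proof -
  have "solid l u \<noteq> {}"
  proof -
    have "Q 0 \<le> 1" unfolding Q_def by simp
    then have "shift l 0 \<in> solid l u" using assms unfolding solid_def gap_def by fastforce
    then show ?thesis by blast
  qed
  then show ?thesis
    unfolding sheet_eq[OF assms]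
    using inside_outside_starlike_diff(1)[OF compact_imp_bounded[OF compact_solid]
      compact_imp_closed[OF compact_solid] open_core core_subset_solid[OF assms] _ solid_starlike]
    by blast
qed

text \<open>\<open>slope P\<close> decreases strictly on the gap, whereas between two critical
  parameters it would have to be both at most 0 and at least 0.\<close>

lemma critical_unique:
  assumes g: "gap l u" and P: "P \<noteq> 0" and c: "critical l u P t" "critical l u P t'"
  shows "t = t'"
proof -
  have False if tt: "t < t'" "critical l u P t" "critical l u P t'" for t t'
  proof -
    define x y where "x = (2 * t + t') / 3" and "y = (t + 2 * t') / 3"
    have xy: "t < x" "x < y" "y < t'" using tt(1) unfolding x_def y_def by auto
    have lu: "l < x" "x < u" "l < y" "y < u" using xy tt(2,3) unfolding critical_def by auto
    have "slope P x \<le> 0" "slope P y \<ge> 0" using tt(2,3) xy lu unfolding critical_def by auto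
    moreover have "slope P y < slope P x"
    proof -
      obtain j where j: "P$j \<noteq> 0" using P by (auto simp: vec_eq_iff)
      have str: "1 / (al i + y) < 1 / (al i + x)" for i
      proof (rule divide_strict_left_mono)
        show "0 < (al i + y) * (al i + x)" using g lu unfolding gap_def zero_less_mult_iff
          by (smt (verit))
      qed (use xy in auto)
      show ?thesis unfolding slope_def
      proof (rule sum_strict_mono_ex1)
        have "(P$i)^2 / al i * (1 / (al i + y)) \<le> (P$i)^2 / al i * (1 / (al i + x))" for i
          using str[of i] al_pos[of i] by (intro mult_left_mono) auto
        then show "\<forall>i\<in>UNIV. (P$i)^2 / al i / (al i + y) \<le> (P$i)^2 / al i / (al i + x)" by simp
        have "(P$j)^2 / al j * (1 / (al j + y)) < (P$j)^2 / al j * (1 / (al j + x))"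
          using str[of j] al_pos[of j] j by (intro mult_strict_left_mono) auto
        then show "\<exists>i\<in>UNIV. (P$i)^2 / al i / (al i + y) < (P$i)^2 / al i / (al i + x)" by auto
      qed simp
    qed
    ultimately show False by simp
  qed
  then show ?thesis using c by (metis linorder_neqE)
qed

end

section \<open>Principal curvatures\<close>

lemma ex_unit_orthogonal2:
  fixes n1 n2 :: real
  obtains x y where "x * n1 + y * n2 = 0" "x^2 + y^2 = 1"
proof (cases "n1 = 0 \<and> n2 = 0")
  case True
  then show ?thesis using that[of 1 0] by simp
next
  case False
  define r where "r = sqrt (n1^2 + n2^2)"
  have "n1^2 + n2^2 \<noteq> 0" using False by (simp add: sum_power2_eq_zero_iff)
  then have r: "r^2 = n1^2 + n2^2" "r \<noteq> 0" by (simp_all add: r_def)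
  have "(- n2 / r) * n1 + (n1 / r) * n2 = 0" by simp
  moreover have "(- n2 / r)^2 + (n1 / r)^2 = (n1^2 + n2^2) / r^2"
    by (simp add: power_divide add_divide_distrib)
  then have "(- n2 / r)^2 + (n1 / r)^2 = 1" unfolding r(1)[symmetric] using r(2) by simp
  ultimately show ?thesis by (rule that)
qed

context ellipsoid
begin

definition nrm :: "real^3 \<Rightarrow> real^3" where
  "nrm P = (\<chi> i. P$i / al i)"

text \<open>The normal curvatures at \<open>P\<close> multiplied by \<open>norm (nrm P)\<close>; in
  this scale an extremal value \<open>x\<close> belongs to the centre
  \<open>shift (- 1 / x) P\<close>.\<close>

definition tangent_values :: "real^3 \<Rightarrow> real set" where
  "tangent_values P = {Q v | v. v \<bullet> nrm P = 0 \<and> norm v = 1}"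

lemma shift_eq_nrm: "shift t P = P + t *\<^sub>R nrm P"
  unfolding shift_def nrm_def vec_eq_iff by (simp add: algebra_simps)

lemma nrm_nonzero: "P \<noteq> 0 \<Longrightarrow> nrm P \<noteq> 0"
  unfolding nrm_def vec_eq_iff using al_pos by (auto simp: less_imp_neq[symmetric])

lemma inner_3: "(v::real^3) \<bullet> w = v$1 * w$1 + v$2 * w$2 + v$3 * w$3"
  by (simp add: inner_vec_def sum_3)

lemma Q_3: "Q v = (v$1)^2 / al 1 + (v$2)^2 / al 2 + (v$3)^2 / al 3"
  unfolding Q_def by (simp add: sum_3)

lemma norm_sq_3: "(norm (v::real^3))^2 = (v$1)^2 + (v$2)^2 + (v$3)^2"
  unfolding power2_norm_eq_inner inner_3 by (simp only: power2_eq_square)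

text \<open>Rescaling extends the bound from unit vectors to the whole plane, where
  \<open>Q v - \<kappa> * (norm v)^2\<close> is a diagonal form. The factor \<open>\<sigma>\<close>
  is 1 for lower and -1 for upper bounds.\<close>

lemma unit_form_iff:
  "(\<forall>v. v \<bullet> n = 0 \<longrightarrow> norm v = 1 \<longrightarrow> \<sigma> * (Q v - \<kappa>) \<ge> 0) \<longleftrightarrow>
   (\<forall>v1 v2 v3. v1 * n$1 + v2 * n$2 + v3 * n$3 = 0 \<longrightarrow>
      \<sigma> * (1 / al 1 - \<kappa>) * v1^2 + \<sigma> * (1 / al 2 - \<kappa>) * v2^2 + \<sigma> * (1 / al 3 - \<kappa>) * v3^2 \<ge> 0)"
    (is "?L \<longleftrightarrow> ?R")
proof
  have form: "\<sigma> * (1 / al 1 - \<kappa>) * (v$1)^2 + \<sigma> * (1 / al 2 - \<kappa>) * (v$2)^2 + \<sigma> * (1 / al 3 - \<kappa>) * (v$3)^2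
      = \<sigma> * (Q v - \<kappa> * (norm v)^2)" for v
    unfolding Q_3 norm_sq_3 by (simp add: algebra_simps)
  {
    assume L: ?L
    show ?R
    proof (intro allI impI)
      fix v1 v2 v3 :: real
      assume orth: "v1 * n$1 + v2 * n$2 + v3 * n$3 = 0"
      define v :: "real^3" where "v = vector [v1, v2, v3]"
      have v: "v$1 = v1" "v$2 = v2" "v$3 = v3" unfolding v_def by simp_all
      have "\<sigma> * (Q v - \<kappa> * (norm v)^2) \<ge> 0"
      proof (cases "v = 0")
        case False
        define r where "r = norm v"
        have r: "r > 0" using False unfolding r_def by simp
        have "\<sigma> * (Q ((1 / r) *\<^sub>R v) - \<kappa>) \<ge> 0"
        proof (rule L[rule_format])
          have "v \<bullet> n = 0" unfolding inner_3 v by (rule orth)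
          then show "((1 / r) *\<^sub>R v) \<bullet> n = 0" by simp
          show "norm ((1 / r) *\<^sub>R v) = 1" using r unfolding r_def by simp
        qed
        moreover have "Q ((1 / r) *\<^sub>R v) = Q v / r^2"
          unfolding Q_def by (simp add: power_divide sum_divide_distrib mult.commute)
        ultimately have "r^2 * (\<sigma> * (Q v / r^2 - \<kappa>)) \<ge> 0" by simp
        also have "r^2 * (\<sigma> * (Q v / r^2 - \<kappa>)) = \<sigma> * (Q v - \<kappa> * r^2)"
          using r by (simp add: field_simps)
        finally show ?thesis unfolding r_def .
      qed (simp add: Q_def)
      then show "\<sigma> * (1 / al 1 - \<kappa>) * v1^2 + \<sigma> * (1 / al 2 - \<kappa>) * v2^2 + \<sigma> * (1 / al 3 - \<kappa>) * v3^2 \<ge> 0"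
        unfolding form[symmetric] v .
    qed
  }
  {
    assume R: ?R
    show ?L
    proof (intro allI impI)
      fix v :: "real^3" assume v: "v \<bullet> n = 0" "norm v = 1"
      then show "\<sigma> * (Q v - \<kappa>) \<ge> 0"
        using R[rule_format, of "v$1" "v$2" "v$3"] unfolding form inner_3 by simp
    qed
  }
qed

text \<open>With \<open>\<kappa> = - 1 / s\<close> the terms of the plane criterion at the normal
  vector become \<open>s\<close> times the terms of \<open>slope P s\<close>.\<close>

lemma slope_dual:
  assumes "s < 0" "\<And>i. al i + s \<noteq> 0"
  shows "(P$i / al i)^2 / (1 / al i - (- 1 / s)) = s * ((P$i)^2 / al i / (al i + s))"
proof -
  have "1 / al i - (- 1 / s) = (al i + s) / (al i * s)"
    using assms(1) al_pos[of i] by (simp add: field_simps)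
  then show ?thesis using assms(1) al_pos[of i] by (simp add: power2_eq_square)
qed

lemma dual_coeff_sign:
  assumes "s < 0"
  shows "1 / al i - (- 1 / s) < 0 \<longleftrightarrow> 0 < al i + s" "0 < 1 / al i - (- 1 / s) \<longleftrightarrow> al i + s < 0"
proof -
  have "1 / al i - (- 1 / s) = (al i + s) / (al i * s)"
    using assms(1) al_pos[of i] by (simp add: field_simps)
  moreover have "al i * s < 0" using assms al_pos[of i] by (simp add: mult_less_0_iff)
  ultimately show "1 / al i - (- 1 / s) < 0 \<longleftrightarrow> 0 < al i + s" "0 < 1 / al i - (- 1 / s) \<longleftrightarrow> al i + s < 0"
    by (simp_all add: divide_less_0_iff zero_less_divide_iff)
qed

text \<open>For \<open>s\<close> in the first gap the diagonal form has exactly one negative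
  coefficient, that of index 1, so the plane criterion applies; the factor \<open>s < 0\<close>
  reverses the inequality.\<close>

lemma tangent_values_ge_iff:
  assumes P: "P \<noteq> 0" and s: "- al 1 < s" "s < - al 2"
  shows "(\<forall>x\<in>tangent_values P. - 1 / s \<le> x) \<longleftrightarrow> slope P s \<ge> 0"
proof -
  let ?d = "\<lambda>i. 1 / al i - (- 1 / s)"
  have s0: "s < 0" using s al_pos[of 2] by simp
  have nz: "al i + s \<noteq> 0" for i using gap_nz[OF gap12 s] .
  have d: "?d 1 < 0" "0 < ?d 2" "0 < ?d 3"
    using s al32 by (simp_all only: dual_coeff_sign[OF s0])
  have n: "nrm P $ 1 \<noteq> 0 \<or> nrm P $ 2 \<noteq> 0 \<or> nrm P $ 3 \<noteq> 0"
    using nrm_nonzero[OF P] by (simp add: vec_eq_iff forall_3)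
  have "(\<forall>x\<in>tangent_values P. - 1 / s \<le> x) \<longleftrightarrow>
      (\<forall>v. v \<bullet> nrm P = 0 \<longrightarrow> norm v = 1 \<longrightarrow> 1 * (Q v - (- 1 / s)) \<ge> 0)"
    unfolding tangent_values_def by auto
  also have "\<dots> \<longleftrightarrow> (nrm P $ 1)^2 / ?d 1 + (nrm P $ 2)^2 / ?d 2 + (nrm P $ 3)^2 / ?d 3 \<le> 0"
    unfolding unit_form_iff unfolding mult_1 by (rule indefinite_form_on_plane[OF d n])
  also have "(nrm P $ 1)^2 / ?d 1 + (nrm P $ 2)^2 / ?d 2 + (nrm P $ 3)^2 / ?d 3 = s * slope P s"
    unfolding nrm_def vec_lambda_beta slope_dual[OF s0 nz] slope_def sum_3 by (simp only: distrib_left)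
  finally show ?thesis using s0 by (simp add: mult_le_0_iff)
qed

text \<open>In the second gap only index 3 has a positive coefficient. The form is negated and index
  3 moved to the front to fit the plane criterion.\<close>

lemma tangent_values_le_iff:
  assumes P: "P \<noteq> 0" and s: "- al 2 < s" "s < - al 3"
  shows "(\<forall>x\<in>tangent_values P. x \<le> - 1 / s) \<longleftrightarrow> slope P s \<le> 0"
proof -
  let ?d = "\<lambda>i. 1 / al i - (- 1 / s)"
  let ?e = "\<lambda>i. - 1 * (1 / al i - (- 1 / s))"
  have s0: "s < 0" using s al_pos[of 3] by simp
  have nz: "al i + s \<noteq> 0" for i using gap_nz[OF gap23 s] .
  have "?d 1 < 0" "?d 2 < 0" "0 < ?d 3"
    using s al21 by (simp_all only: dual_coeff_sign[OF s0])
  then have e: "?e 3 < 0" "0 < ?e 1" "0 < ?e 2" unfolding mult_minus1 neg_less_0_iff_less neg_0_less_iff_less by blast+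
  have n: "nrm P $ 3 \<noteq> 0 \<or> nrm P $ 1 \<noteq> 0 \<or> nrm P $ 2 \<noteq> 0"
    using nrm_nonzero[OF P] by (auto simp: vec_eq_iff forall_3)
  have "(\<forall>x\<in>tangent_values P. x \<le> - 1 / s) \<longleftrightarrow>
      (\<forall>v. v \<bullet> nrm P = 0 \<longrightarrow> norm v = 1 \<longrightarrow> - 1 * (Q v - (- 1 / s)) \<ge> 0)"
    unfolding tangent_values_def by auto
  also have "\<dots> \<longleftrightarrow> (\<forall>v3 v1 v2. v3 * nrm P $ 3 + v1 * nrm P $ 1 + v2 * nrm P $ 2 = 0 \<longrightarrow>
      ?e 3 * v3^2 + ?e 1 * v1^2 + ?e 2 * v2^2 \<ge> 0)"
    unfolding unit_form_iff by (auto simp only: add.assoc add.commute add.left_commute)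
  also have "\<dots> \<longleftrightarrow> (nrm P $ 3)^2 / ?e 3 + (nrm P $ 1)^2 / ?e 1 + (nrm P $ 2)^2 / ?e 2 \<le> 0"
    by (rule indefinite_form_on_plane[OF e n])
  also have "(nrm P $ 3)^2 / ?e 3 + (nrm P $ 1)^2 / ?e 1 + (nrm P $ 2)^2 / ?e 2 = - (s * slope P s)"
  proof -
    have "(nrm P $ i)^2 / ?e i = - (s * ((P$i)^2 / al i / (al i + s)))" for i
      unfolding nrm_def vec_lambda_beta slope_dual[OF s0 nz, symmetric]
      by (simp only: mult_minus1 divide_minus_right)
    then show ?thesis unfolding slope_def sum_3 by (simp add: distrib_left)
  qed
  finally show ?thesis using s0 by (auto simp: zero_le_mult_iff)
qed

lemma tangent_values_bounds:
  assumes "x \<in> tangent_values P"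
  shows "1 / al 1 \<le> x" "x \<le> 1 / al 3"
proof -
  obtain v where v: "x = Q v" "norm v = 1" using assms unfolding tangent_values_def by auto
  then have n: "(v$1)^2 + (v$2)^2 + (v$3)^2 = 1" using norm_sq_3[of v] by simp
  have c: "1 / al 1 \<le> 1 / al i" "1 / al i \<le> 1 / al 3" for i
    using exhaust_3[of i] al_pos[of 1] al_pos[of 2] al_pos[of 3] al32 al21
    by (auto intro!: divide_left_mono)
  have "(1 / al 1) * ((v$1)^2 + (v$2)^2 + (v$3)^2) \<le> Q v"
    unfolding Q_3 using mult_left_mono[OF c(1), of "(v$2)^2" 2] mult_left_mono[OF c(1), of "(v$3)^2" 3]
    by (simp add: distrib_left)
  moreover have "Q v \<le> (1 / al 3) * ((v$1)^2 + (v$2)^2 + (v$3)^2)"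
    unfolding Q_3 using mult_left_mono[OF c(2), of "(v$2)^2" 2] mult_left_mono[OF c(2), of "(v$1)^2" 1]
    by (simp add: distrib_left)
  ultimately show "1 / al 1 \<le> x" "x \<le> 1 / al 3" using n v by simp_all
qed

text \<open>Tangent vectors with third, respectively first, coordinate 0 give values on both sides
  of \<open>1 / al 2\<close>. This assigns the least value to the first gap and the greatest to the
  second.\<close>

lemma tangent_values_middle:
  obtains x y where "x \<in> tangent_values P" "y \<in> tangent_values P" "x \<le> 1 / al 2" "1 / al 2 \<le> y"
proof -
  have c: "1 / al 1 \<le> 1 / al 2" "1 / al 2 \<le> 1 / al 3"
    using al_pos[of 1] al_pos[of 2] al_pos[of 3] al32 al21 by (auto intro!: divide_left_mono)
  obtain p q where pq: "p * nrm P $ 1 + q * nrm P $ 2 = 0" "p^2 + q^2 = 1" by (rule ex_unit_orthogonal2)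
  obtain p' q' where pq': "p' * nrm P $ 2 + q' * nrm P $ 3 = 0" "p'^2 + q'^2 = 1" by (rule ex_unit_orthogonal2)
  define v w :: "real^3" where "v = vector [p, q, 0]" and "w = vector [0, p', q']"
  have "(norm v)^2 = 1" "(norm w)^2 = 1" unfolding norm_sq_3 v_def w_def using pq pq' by simp_all
  then have "norm v = 1" "norm w = 1" by (simp_all add: power2_eq_1_iff) (smt (verit) norm_ge_zero)+
  moreover have "v \<bullet> nrm P = 0" "w \<bullet> nrm P = 0" unfolding inner_3 v_def w_def using pq pq' by simp_all
  ultimately have "Q v \<in> tangent_values P" "Q w \<in> tangent_values P" unfolding tangent_values_def by blast+
  moreover have "Q v \<le> 1 / al 2"
  proof -
    have "Q v = (1 / al 1) * p^2 + (1 / al 2) * q^2" unfolding Q_3 v_def by simp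
    also have "\<dots> \<le> (1 / al 2) * p^2 + (1 / al 2) * q^2" using c(1) by (intro add_right_mono mult_right_mono) auto
    also have "\<dots> = 1 / al 2" using pq(2) by (metis distrib_left mult.right_neutral)
    finally show ?thesis .
  qed
  moreover have "1 / al 2 \<le> Q w"
  proof -
    have "1 / al 2 = (1 / al 2) * p'^2 + (1 / al 2) * q'^2" using pq'(2) by (metis distrib_left mult.right_neutral)
    also have "\<dots> \<le> (1 / al 2) * p'^2 + (1 / al 3) * q'^2" using c(2) by (intro add_left_mono mult_right_mono) auto
    also have "\<dots> = Q w" unfolding Q_3 w_def by simp
    finally show ?thesis .
  qed
  ultimately show ?thesis by (rule that)
qed

lemma neg_inverse_less_iff:
  fixes X s :: real
  assumes "X > 0" "s < 0"
  shows "s < - 1 / X \<longleftrightarrow> - 1 / s < X" "- 1 / X < s \<longleftrightarrow> X < - 1 / s"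
  using assms by (auto simp: field_simps)

text \<open>\<open>X\<close> enters through the order characterisation of the infimum, so the signs
  of the slope follow without finding a minimising vector. The bounds \<open>1 / al 1\<close> and
  \<open>1 / al 2\<close> place \<open>- 1 / X\<close> in the closed gap.\<close>

lemma critical_least:
  assumes P: "P \<noteq> 0" and X: "\<And>\<mu>. \<mu> \<le> X \<longleftrightarrow> (\<forall>x\<in>tangent_values P. \<mu> \<le> x)"
  shows "critical (- al 1) (- al 2) P (- 1 / X)"
proof -
  have 1: "1 / al 1 \<le> X" using X tangent_values_bounds(1) by blast
  moreover have "1 / al 1 > 0" using al_pos[of 1] by simp
  ultimately have X0: "X > 0" by linarith
  have 2: "X \<le> 1 / al 2" using X[of X] tangent_values_middle[of P] by (metis order.refl order.trans)
  have "- al 1 \<le> - 1 / X" "- 1 / X \<le> - al 2" using 1 2 X0 al_pos[of 1] al_pos[of 2]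
    by (auto simp: field_simps)
  moreover have "(s < - 1 / X \<longrightarrow> slope P s \<ge> 0) \<and> (- 1 / X < s \<longrightarrow> slope P s \<le> 0)"
    if s: "- al 1 < s" "s < - al 2" for s
  proof -
    have "s < 0" using s al_pos[of 2] by simp
    then show ?thesis using neg_inverse_less_iff[OF X0] X[of "- 1 / s"] tangent_values_ge_iff[OF P s] by force
  qed
  ultimately show ?thesis unfolding critical_def by blast
qed

lemma critical_greatest:
  assumes P: "P \<noteq> 0" and X: "\<And>\<mu>. X \<le> \<mu> \<longleftrightarrow> (\<forall>x\<in>tangent_values P. x \<le> \<mu>)"
  shows "critical (- al 2) (- al 3) P (- 1 / X)"
proof -
  have 1: "X \<le> 1 / al 3" using X tangent_values_bounds(2) by blast
  have 2: "1 / al 2 \<le> X" using X[of X] tangent_values_middle[of P] by (metis order.refl order.trans)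
  moreover have "1 / al 2 > 0" using al_pos[of 2] by simp
  ultimately have X0: "X > 0" by linarith
  have "- al 2 \<le> - 1 / X" "- 1 / X \<le> - al 3" using 1 2 X0 al_pos[of 3] al_pos[of 2]
    by (auto simp: field_simps)
  moreover have "(s < - 1 / X \<longrightarrow> slope P s \<ge> 0) \<and> (- 1 / X < s \<longrightarrow> slope P s \<le> 0)"
    if s: "- al 2 < s" "s < - al 3" for s
  proof -
    have "s < 0" using s al_pos[of 3] by simp
    then show ?thesis using neg_inverse_less_iff[OF X0] X[of "- 1 / s"] tangent_values_le_iff[OF P s] by force
  qed
  ultimately show ?thesis unfolding critical_def by blast
qed

end

section \<open>The ellipsoid and its sheets\<close>

context ellipsoid
begin

text \<open>The hypotheses give \<open>- 2 * al i < t\<close> and \<open>t < 0\<close>, so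
  \<open>shift t\<close> multiplies every coordinate by a factor of modulus below 1.\<close>

lemma sheet_disjoint_surface:
  assumes "\<And>i. - 2 * al i < l" "u < 0"
  shows "sheet l u \<inter> {A. Q A = 1} = {}"
proof -
  have "Q (shift t P) < 1" if "l \<le> t" "t \<le> u" "Q P = 1" for t P
  proof -
    have sq: "(1 + t / al i)^2 < 1" for i
    proof -
      have "\<bar>1 + t / al i\<bar> < 1" using al_pos[of i] assms(1)[of i] assms(2) that(1,2)
        by (auto simp: abs_less_iff field_simps)
      then show ?thesis by (simp add: abs_square_less_1)
    qed
    have "P \<noteq> 0" using that(3) unfolding Q_def by auto
    then obtain j where j: "P$j \<noteq> 0" by (auto simp: vec_eq_iff)
    have "Q (shift t P) = (\<Sum>i\<in>UNIV. (P$i)^2 / al i * (1 + t / al i)^2)"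
      unfolding Q_def shift_def by (simp add: power_mult_distrib)
    also have "\<dots> < (\<Sum>i\<in>UNIV. (P$i)^2 / al i)"
    proof (rule sum_strict_mono_ex1)
      have "(P$i)^2 / al i * (1 + t / al i)^2 \<le> (P$i)^2 / al i * 1" for i
        using al_pos[of i] sq[of i] by (intro mult_left_mono) auto
      then show "\<forall>i\<in>UNIV. (P$i)^2 / al i * (1 + t / al i)^2 \<le> (P$i)^2 / al i" by simp
      have "(P$j)^2 / al j * (1 + t / al j)^2 < (P$j)^2 / al j * 1"
        using al_pos[of j] sq[of j] j by (intro mult_strict_left_mono) auto
      then show "\<exists>i\<in>UNIV. (P$i)^2 / al i * (1 + t / al i)^2 < (P$i)^2 / al i" by auto
    qed simp
    finally show ?thesis using that(3) unfolding Q_def by simp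
  qed
  then show ?thesis unfolding sheet_def critical_def by fastforce
qed

text \<open>\<open>P\<close> is the point of the third axis that \<open>shift l\<close> sends to the
  vertex. Since \<open>al 3 + l \<le> - al 3\<close>, it satisfies
  \<open>Q P \<le> 1\<close>.\<close>

lemma short_vertex_in_solid:
  assumes "l \<le> u" "l \<le> - 2 * al 3"
  shows "axis 3 (sqrt (al 3)) \<in> solid l u"
proof -
  define P :: "real^3" where "P = axis 3 (sqrt (al 3) * (al 3 / (al 3 + l)))"
  have nz: "al 3 + l < 0" using assms(2) al3 by linarith
  have "\<bar>al 3 / (al 3 + l)\<bar> \<le> 1" using nz assms(2) al3 by (simp add: abs_divide field_simps)
  then have "(al 3 / (al 3 + l))^2 \<le> 1" by (simp add: abs_square_le_1)
  moreover have "Q P = (al 3 / (al 3 + l))^2"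
  proof -
    have "(sqrt (al 3) * x)^2 / al 3 = x^2" for x using al3 by (simp add: power_mult_distrib)
    moreover have "P$1 = 0" "P$2 = 0" "P$3 = sqrt (al 3) * (al 3 / (al 3 + l))"
      unfolding P_def by (simp_all add: axis_def)
    ultimately show ?thesis unfolding Q_3 by (simp del: times_divide_eq_right)
  qed
  ultimately have "Q P \<le> 1" by simp
  moreover have "axis 3 (sqrt (al 3)) = shift l P"
    unfolding eq_shift_iff P_def forall_3 axis_def using nz al3 by (simp add: field_simps)
  ultimately show ?thesis using solidI[of l l u P] assms(1) by simp
qed

lemma long_vertex_not_in_solid:
  assumes "- al 1 \<le> l" "u < 0"
  shows "axis 1 (sqrt (al 1)) \<notin> solid l u"
proof
  assume "axis 1 (sqrt (al 1)) \<in> solid l u"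
  then obtain t P where tP: "axis 1 (sqrt (al 1)) = shift t P" "l \<le> t" "t \<le> u" "Q P \<le> 1"
    unfolding solid_def by auto
  have "axis 1 (sqrt (al 1)) $ (1::3) = shift t P $ 1" using tP(1) by simp
  then have e: "sqrt (al 1) = P$1 * (1 + t / al 1)" unfolding shift_def by (simp add: axis_def)
  have "(P$1)^2 / al 1 \<le> Q P" unfolding Q_def
    using al_pos by (intro member_le_sum) (auto simp: less_imp_le)
  then have P1: "(P$1)^2 / al 1 \<le> 1" using tP(4) by simp
  have "\<bar>1 + t / al 1\<bar> < 1" using assms tP al_pos[of 1] by (auto simp: abs_less_iff field_simps)
  then have "(1 + t / al 1)^2 < 1" by (simp add: abs_square_less_1)
  moreover have "(P$1)^2 / al 1 * (1 + t / al 1)^2 = 1"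
  proof -
    have "(P$1)^2 / al 1 * (1 + t / al 1)^2 = (P$1 * (1 + t / al 1))^2 / al 1"
      by (simp add: power_mult_distrib)
    then show ?thesis unfolding e[symmetric] using al_pos[of 1] by simp
  qed
  moreover have "(P$1)^2 / al 1 * (1 + t / al 1)^2 \<le> 1 * (1 + t / al 1)^2"
    using P1 by (intro mult_right_mono) auto
  ultimately show False by simp
qed

text \<open>If the sheet missed the ellipsoid, the arc from the short to the long vertex would be
  covered by the disjoint open sets \<open>core l u\<close> and \<open>- solid l u\<close>, and
  would meet both.\<close>

lemma sheet_meets_surface:
  assumes g: "gap l u" and "l \<le> - 2 * al 3" "- al 1 \<le> l" "u < 0"
  shows "sheet l u \<inter> {A. Q A = 1} \<noteq> {}"
proof
  assume empty: "sheet l u \<inter> {A. Q A = 1} = {}"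
  define x z :: "real^3" where "x = axis 1 (sqrt (al 1))" and "z = axis 3 (sqrt (al 3))"
  define \<gamma> where "\<gamma> \<theta> = sin \<theta> *\<^sub>R x + cos \<theta> *\<^sub>R z" for \<theta> :: real
  have Q1: "Q (\<gamma> \<theta>) = 1" for \<theta>
    unfolding Q_3 \<gamma>_def x_def z_def using al_pos[of 1] al_pos[of 3]
    by (simp add: axis_def power_mult_distrib)
  have "connected (\<gamma> ` {0..pi/2})"
    unfolding \<gamma>_def by (intro connected_continuous_image continuous_intros) simp
  moreover have "open (- solid l u)" using compact_imp_closed[OF compact_solid] by (simp add: open_Compl)
  moreover have "core l u \<inter> - solid l u \<inter> \<gamma> ` {0..pi/2} = {}" using core_subset_solid[OF g] by blast
  moreover have "\<gamma> ` {0..pi/2} \<subseteq> core l u \<union> - solid l u"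
    using empty Q1 unfolding sheet_eq[OF g] by blast
  ultimately have "core l u \<inter> \<gamma> ` {0..pi/2} = {} \<or> - solid l u \<inter> \<gamma> ` {0..pi/2} = {}"
    using connectedD[of "\<gamma> ` {0..pi/2}" "core l u" "- solid l u"] open_core by blast
  moreover have "\<gamma> 0 \<in> solid l u"
    using short_vertex_in_solid[of l u] assms g unfolding \<gamma>_def z_def gap_def by simp
  moreover have "\<gamma> 0 \<in> \<gamma> ` {0..pi/2}" "\<gamma> (pi/2) \<in> \<gamma> ` {0..pi/2}" by simp_all
  ultimately have "\<gamma> 0 \<in> core l u \<inter> \<gamma> ` {0..pi/2}" "- solid l u \<inter> \<gamma> ` {0..pi/2} = {}"
    using \<open>\<gamma> ` {0..pi/2} \<subseteq> core l u \<union> - solid l u\<close> by blast+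
  moreover have "\<gamma> (pi/2) \<notin> solid l u"
    using long_vertex_not_in_solid[of l u] assms unfolding \<gamma>_def x_def by simp
  ultimately show False using \<open>\<gamma> (pi/2) \<in> \<gamma> ` {0..pi/2}\<close> by blast
qed

section \<open>Counting feet on and off the sheets\<close>

lemma card_feet_off_sheets:
  assumes "A \<noteq> 0" and 1: "A \<notin> sheet (- al 1) (- al 2)" and 2: "A \<notin> sheet (- al 2) (- al 3)"
  shows "card (feet A) = 2 + (if A \<in> core (- al 1) (- al 2) then 2 else 0)
    + (if A \<in> core (- al 2) (- al 3) then 2 else 0)"
proof -
  obtain i where "A$i \<noteq> 0" using assms(1) by (auto simp: vec_eq_iff)
  then have "\<exists>l. mass A l > 0" using mass_pos by blast
  then show ?thesis unfolding card_feet[OF assms(1)] core_def mem_Collect_eq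
  proof (rule full_count_eq[of "mass A", OF mass_nonneg _ UNIV_3 al32 al21])
    show "dips al (mass A) (- al 1) (- al 2) \<or> stays_above al (mass A) (- al 1) (- al 2)"
      using 1 not_solid_stays_above unfolding sheet_eq[OF gap12] core_def by blast
    show "dips al (mass A) (- al 2) (- al 3) \<or> stays_above al (mass A) (- al 2) (- al 3)"
      using 2 not_solid_stays_above unfolding sheet_eq[OF gap23] core_def by blast
  qed
qed

text \<open>As \<open>A\<close> has no zero coordinate, the parameter \<open>t\<close> cannot be a
  pole and lies strictly inside the gap; the pole sum of \<open>A\<close> there equals
  \<open>Q P\<close>.\<close>

lemma sheet_interior_root:
  assumes "gap l u" "A \<in> sheet l u" "\<And>i. A$i \<noteq> 0" "l = - al i" "u = - al j"
  obtains t where "l < t" "t < u" "pole_sum al (mass A) t = 1"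
proof -
  obtain t P where tP: "A = shift t P" "Q P = 1" "critical l u P t"
    using assms(2) unfolding sheet_def by auto
  have nz: "al i + t \<noteq> 0" for i
  proof
    assume "al i + t = 0"
    then have "al i * A$i = 0" using tP(1) unfolding eq_shift_iff by simp
    then show False using assms(3)[of i] al_pos[of i] by simp
  qed
  have "l < t" "t < u" using tP(3) nz[of i] nz[of j] assms(4,5) unfolding critical_def by force+
  moreover have "pole_sum al (mass A) t = 1"
    using tP(2) unfolding tP(1) pole_sum_shift[OF nz] Q_def by (simp add: nz)
  ultimately show ?thesis by (rule that)
qed

lemma card_feet_on_one_sheet:
  assumes nz: "\<And>i. A$i \<noteq> 0"
    and "A \<in> sheet (- al 1) (- al 2) \<and> A \<notin> sheet (- al 2) (- al 3)
      \<or> A \<in> sheet (- al 2) (- al 3) \<and> A \<notin> sheet (- al 1) (- al 2)"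
  shows "card (feet A) \<in> {3, 5}"
proof -
  have A0: "A \<noteq> 0" using nz[of 1] by auto
  have pos: "mass A i > 0" for i using mass_pos nz by blast
  show ?thesis using assms(2)
  proof (elim disjE conjE)
    assume on: "A \<in> sheet (- al 1) (- al 2)" and off: "A \<notin> sheet (- al 2) (- al 3)"
    obtain t where t: "- al 1 < t" "t < - al 2" "pole_sum al (mass A) t = 1"
      using sheet_interior_root[OF gap12 on nz refl refl] .
    show ?thesis unfolding card_feet[OF A0]
    proof (rule full_count_boundary[of "mass A", OF pos UNIV_3 al32 al21 _ t])
      show "\<not> dips al (mass A) (- al 1) (- al 2)" using on unfolding sheet_eq[OF gap12] core_def by blast
      show "dips al (mass A) (- al 2) (- al 3) \<or> stays_above al (mass A) (- al 2) (- al 3)"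
        using off not_solid_stays_above unfolding sheet_eq[OF gap23] core_def by blast
    qed
  next
    assume on: "A \<in> sheet (- al 2) (- al 3)" and off: "A \<notin> sheet (- al 1) (- al 2)"
    obtain t where t: "- al 2 < t" "t < - al 3" "pole_sum al (mass A) t = 1"
      using sheet_interior_root[OF gap23 on nz refl refl] .
    \<comment> \<open>Reflection makes the second gap the leftmost one.\<close>
    have "full_count (\<lambda>i. - al i) (mass A) \<in> {3, 5}"
    proof (rule full_count_boundary[of "mass A" 3 2 1 "\<lambda>i. - al i" "- t", OF pos])
      show "UNIV = {3, 2, 1 :: 3}" using UNIV_3 by blast
      show "\<not> dips (\<lambda>i. - al i) (mass A) (- (- al 3)) (- (- al 2))"
        using on unfolding sheet_eq[OF gap23] core_def by (simp add: dips_minus)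
      show "dips (\<lambda>i. - al i) (mass A) (- (- al 2)) (- (- al 1)) \<or>
          stays_above (\<lambda>i. - al i) (mass A) (- (- al 2)) (- (- al 1))"
        using off not_solid_stays_above unfolding sheet_eq[OF gap12] core_def
        by (auto simp: dips_minus stays_above_minus)
    qed (use t al32 al21 in \<open>auto simp: pole_sum_minus\<close>)
    then show ?thesis unfolding card_feet[OF A0] full_count_minus .
  qed
qed

end

section \<open>The ellipsoid with semi-axes a, b, c\<close>

definition axes :: "real \<Rightarrow> real \<Rightarrow> real \<Rightarrow> 3 \<Rightarrow> real" where
  "axes a b c i = (if i = 1 then a^2 else if i = 2 then b^2 else c^2)"

lemma axes_simps [simp]: "axes a b c 1 = a^2" "axes a b c 2 = b^2" "axes a b c 3 = c^2"
  unfolding axes_def by simp_all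

locale triaxial =
  fixes a b c :: real
  assumes c_pos: "0 < c" and c_less_b: "c < b" and b_less_a: "b < a"

sublocale triaxial \<subseteq> ellipsoid "axes a b c"
  by unfold_locales (use c_pos c_less_b b_less_a in \<open>auto intro: power_strict_mono\<close>)

context triaxial
begin

lemma ell_eq: "ell a b c = {P. Q P = 1}"
  unfolding ell_def Q_3 by simp

lemma ell_nonzero: "P \<in> ell a b c \<Longrightarrow> P \<noteq> 0"
  unfolding ell_eq Q_def by auto

lemma ell_normal_eq: "ell_normal a b c P = nrm P"
  unfolding ell_normal_def nrm_def vec_eq_iff forall_3 by simp

lemma nnormals_eq: "nnormals a b c A = card (feet A)"
  unfolding nnormals_def feet_def ell_eq ell_normal_eq shift_eq_nrm by simp

lemma normal_curvatures_eq:
  "normal_curvatures a b c P = (\<lambda>x. x / norm (nrm P)) ` tangent_values P"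
  unfolding normal_curvatures_def tangent_values_def ell_II_def ell_normal_eq Q_3 by auto

lemma tangent_values_nonempty: "tangent_values P \<noteq> {}"
  using tangent_values_middle[of P] by blast

lemma k1_scaled:
  assumes "P \<noteq> 0"
  shows "\<mu> \<le> k1 a b c P * norm (nrm P) \<longleftrightarrow> (\<forall>x\<in>tangent_values P. \<mu> \<le> x)"
proof -
  have n: "norm (nrm P) > 0" using nrm_nonzero[OF assms] by simp
  have bdd: "bdd_below (normal_curvatures a b c P)"
    unfolding normal_curvatures_eq
    by (rule bdd_belowI2[of _ "(1 / axes a b c 1) / norm (nrm P)"])
      (use n in \<open>intro divide_right_mono tangent_values_bounds(1); simp\<close>)
  have "\<mu> \<le> k1 a b c P * norm (nrm P) \<longleftrightarrow> \<mu> / norm (nrm P) \<le> k1 a b c P"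
    using n by (simp add: pos_divide_le_eq)
  also have "\<dots> \<longleftrightarrow> (\<forall>y\<in>normal_curvatures a b c P. \<mu> / norm (nrm P) \<le> y)"
    unfolding k1_def using bdd tangent_values_nonempty
    by (intro le_cInf_iff) (auto simp: normal_curvatures_eq)
  finally show ?thesis unfolding normal_curvatures_eq using n by (simp add: divide_le_cancel)
qed

lemma k2_scaled:
  assumes "P \<noteq> 0"
  shows "k2 a b c P * norm (nrm P) \<le> \<mu> \<longleftrightarrow> (\<forall>x\<in>tangent_values P. x \<le> \<mu>)"
proof -
  have n: "norm (nrm P) > 0" using nrm_nonzero[OF assms] by simp
  have bdd: "bdd_above (normal_curvatures a b c P)"
    unfolding normal_curvatures_eq
    by (rule bdd_aboveI2[of _ _ "(1 / axes a b c 3) / norm (nrm P)"])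
      (use n in \<open>intro divide_right_mono tangent_values_bounds(2); simp\<close>)
  have "k2 a b c P * norm (nrm P) \<le> \<mu> \<longleftrightarrow> k2 a b c P \<le> \<mu> / norm (nrm P)"
    using n by (simp add: pos_le_divide_eq)
  also have "\<dots> \<longleftrightarrow> (\<forall>y\<in>normal_curvatures a b c P. y \<le> \<mu> / norm (nrm P))"
    unfolding k2_def using bdd tangent_values_nonempty
    by (intro cSup_le_iff) (auto simp: normal_curvatures_eq)
  finally show ?thesis unfolding normal_curvatures_eq using n by (simp add: divide_le_cancel)
qed

lemma centre1_eq: "centre1 a b c P = shift (- 1 / (k1 a b c P * norm (nrm P))) P"
  unfolding centre1_def ell_normal_eq shift_eq_nrm by (simp add: divide_inverse)

lemma centre2_eq: "centre2 a b c P = shift (- 1 / (k2 a b c P * norm (nrm P))) P"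
  unfolding centre2_def ell_normal_eq shift_eq_nrm by (simp add: divide_inverse)

text \<open>For each \<open>P\<close> the parameter of its centre is critical, and critical
  parameters are unique, so the two descriptions of the sheet agree.\<close>

lemma sheet1_eq: "sheet1 a b c = sheet (- (a^2)) (- (b^2))"
proof -
  have crit: "critical (- (a^2)) (- (b^2)) P (- 1 / (k1 a b c P * norm (nrm P)))" if "P \<in> ell a b c" for P
    using critical_least[OF ell_nonzero[OF that] k1_scaled[OF ell_nonzero[OF that]]] by simp
  have gap: "gap (- (a^2)) (- (b^2))" using gap12 by simp
  show ?thesis
  proof (intro set_eqI iffI)
    fix A assume "A \<in> sheet1 a b c"
    then obtain P where P: "P \<in> ell a b c" "A = centre1 a b c P" unfolding sheet1_def by blast
    then show "A \<in> sheet (- (a^2)) (- (b^2))"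
      using crit[OF P(1)] unfolding sheet_def ell_eq centre1_eq by blast
  next
    fix A assume "A \<in> sheet (- (a^2)) (- (b^2))"
    then obtain t P where tP: "A = shift t P" "P \<in> ell a b c" "critical (- (a^2)) (- (b^2)) P t"
      unfolding sheet_def ell_eq by blast
    then have "A = centre1 a b c P"
      using critical_unique[OF gap ell_nonzero[OF tP(2)] tP(3) crit[OF tP(2)]] unfolding centre1_eq by simp
    then show "A \<in> sheet1 a b c" using tP(2) unfolding sheet1_def by blast
  qed
qed

lemma sheet2_eq: "sheet2 a b c = sheet (- (b^2)) (- (c^2))"
proof -
  have crit: "critical (- (b^2)) (- (c^2)) P (- 1 / (k2 a b c P * norm (nrm P)))" if "P \<in> ell a b c" for P
    using critical_greatest[OF ell_nonzero[OF that] k2_scaled[OF ell_nonzero[OF that]]] by simp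
  have gap: "gap (- (b^2)) (- (c^2))" using gap23 by simp
  show ?thesis
  proof (intro set_eqI iffI)
    fix A assume "A \<in> sheet2 a b c"
    then obtain P where P: "P \<in> ell a b c" "A = centre2 a b c P" unfolding sheet2_def by blast
    then show "A \<in> sheet (- (b^2)) (- (c^2))"
      using crit[OF P(1)] unfolding sheet_def ell_eq centre2_eq by blast
  next
    fix A assume "A \<in> sheet (- (b^2)) (- (c^2))"
    then obtain t P where tP: "A = shift t P" "P \<in> ell a b c" "critical (- (b^2)) (- (c^2)) P t"
      unfolding sheet_def ell_eq by blast
    then have "A = centre2 a b c P"
      using critical_unique[OF gap ell_nonzero[OF tP(2)] tP(3) crit[OF tP(2)]] unfolding centre2_eq by simp
    then show "A \<in> sheet2 a b c" using tP(2) unfolding sheet2_def by blast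
  qed
qed

end

theorem theorem4:
  fixes a b c :: real
  assumes "0 < c" and "c < b" and "b < a"
  defines "E \<equiv> ell a b c" and "S1 \<equiv> sheet1 a b c" and "S2 \<equiv> sheet2 a b c"
  shows "(a^2 < 2*c^2 \<longrightarrow> S1 \<inter> E = {} \<and> S2 \<inter> E = {})
       \<and> (b^2 < 2*c^2 \<and> 2*c^2 \<le> a^2 \<longrightarrow> (S1 \<inter> E \<noteq> {}) \<noteq> (S2 \<inter> E \<noteq> {}))
       \<and> (b^2 \<ge> 2*c^2 \<longrightarrow> S1 \<inter> E \<noteq> {} \<and> S2 \<inter> E \<noteq> {})
       \<and> (\<forall>A \<in> E - exceptional a b c.
            (A \<in> outside S1 \<and> A \<in> outside S2 \<longrightarrow> nnormals a b c A = 2)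
          \<and> ((A \<in> inside S1 \<and> A \<in> outside S2) \<or> (A \<in> outside S1 \<and> A \<in> inside S2)
               \<longrightarrow> nnormals a b c A = 4)
          \<and> (A \<in> inside S1 \<and> A \<in> inside S2 \<longrightarrow> nnormals a b c A = 6)
          \<and> (A \<in> S1 \<union> S2 \<longrightarrow> nnormals a b c A \<in> {3, 5}))"
proof -
  interpret triaxial a b c using assms(1-3) by unfold_locales
  have gap1: "gap (- (a^2)) (- (b^2))" and gap2: "gap (- (b^2)) (- (c^2))" using gap12 gap23 by simp_all
  have cb: "c^2 < b^2" and ba: "b^2 < a^2" and c0: "0 < c^2" using al32 al21 al3 by simp_all
  have ax: "c^2 \<le> axes a b c i" for i unfolding axes_def using cb ba by simp
  have disj1: "S1 \<inter> E = {}" if "a^2 < 2*c^2"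
    unfolding S1_def E_def sheet1_eq ell_eq
    by (rule sheet_disjoint_surface) (use that ax cb c0 in \<open>smt (verit)\<close>)+
  have disj2: "S2 \<inter> E = {}" if "b^2 < 2*c^2"
    unfolding S2_def E_def sheet2_eq ell_eq
    by (rule sheet_disjoint_surface) (use that ax cb c0 in \<open>smt (verit)\<close>)+
  have meet1: "S1 \<inter> E \<noteq> {}" if "2*c^2 \<le> a^2"
    unfolding S1_def E_def sheet1_eq ell_eq
    by (rule sheet_meets_surface[OF gap1]) (use that cb c0 in auto)
  have meet2: "S2 \<inter> E \<noteq> {}" if "2*c^2 \<le> b^2"
    unfolding S2_def E_def sheet2_eq ell_eq
    by (rule sheet_meets_surface[OF gap2]) (use that cb c0 ba in auto)
  let ?C1 = "core (- (a^2)) (- (b^2))" and ?C2 = "core (- (b^2)) (- (c^2))"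
  \<comment> \<open>Only the inside is identified with a core; for the outside, disjointness from
    the sheet and from its inside suffices.\<close>
  have in1: "inside S1 = ?C1" "S1 \<inter> outside S1 = {}" "S1 \<inter> inside S1 = {}" "inside S1 \<inter> outside S1 = {}"
    and in2: "inside S2 = ?C2" "S2 \<inter> outside S2 = {}" "S2 \<inter> inside S2 = {}" "inside S2 \<inter> outside S2 = {}"
    using inside_sheet[OF gap1] inside_sheet[OF gap2] unfolding S1_def S2_def sheet1_eq sheet2_eq
    by (auto simp: inside_def outside_def)
  have count: "nnormals a b c A = 2 + (if A \<in> inside S1 then 2 else 0) + (if A \<in> inside S2 then 2 else 0)"
    if "A \<in> E" "A \<notin> S1" "A \<notin> S2" for A
    using card_feet_off_sheets[OF ell_nonzero, of A] that
    unfolding nnormals_eq in1(1) in2(1) unfolding S1_def S2_def E_def sheet1_eq sheet2_eq by simp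
  have on: "nnormals a b c A \<in> {3, 5}" if A: "A \<in> E - exceptional a b c" "A \<in> S1 \<union> S2" for A
  proof -
    \<comment> \<open>The exceptional set enters here: the point is not on both sheets and is off
      the coordinate planes.\<close>
    have "A \<notin> coord_planes" "\<not> (A \<in> S1 \<and> A \<in> S2)"
      using A unfolding exceptional_def E_def S1_def S2_def by blast+
    then have "\<And>i. A$i \<noteq> 0" unfolding coord_planes_def using forall_3[of "\<lambda>i. A$i \<noteq> 0"] by simp
    then show ?thesis unfolding nnormals_eq
    proof (rule card_feet_on_one_sheet)
      show "A \<in> sheet (- axes a b c 1) (- axes a b c 2) \<and> A \<notin> sheet (- axes a b c 2) (- axes a b c 3)
        \<or> A \<in> sheet (- axes a b c 2) (- axes a b c 3) \<and> A \<notin> sheet (- axes a b c 1) (- axes a b c 2)"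
        using \<open>\<not> (A \<in> S1 \<and> A \<in> S2)\<close> A(2) unfolding S1_def S2_def sheet1_eq sheet2_eq by simp blast
    qed
  qed
  have off: "(A \<in> outside S1 \<and> A \<in> outside S2 \<longrightarrow> nnormals a b c A = 2)
          \<and> ((A \<in> inside S1 \<and> A \<in> outside S2) \<or> (A \<in> outside S1 \<and> A \<in> inside S2)
               \<longrightarrow> nnormals a b c A = 4)
          \<and> (A \<in> inside S1 \<and> A \<in> inside S2 \<longrightarrow> nnormals a b c A = 6)" if "A \<in> E" for A
  proof (cases "A \<in> S1 \<or> A \<in> S2")
    case True
    then show ?thesis using in1(2,3) in2(2,3) by blast
  next
    case False
    then have "A \<notin> S1" "A \<notin> S2" by auto
    moreover have "A \<in> outside S1 \<Longrightarrow> A \<notin> inside S1" "A \<in> outside S2 \<Longrightarrow> A \<notin> inside S2"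
      using in1(4) in2(4) by blast+
    ultimately show ?thesis using count[OF that] by auto
  qed
  \<comment> \<open>If \<open>a^2 < 2*c^2\<close> then also \<open>b^2 < 2*c^2\<close>, and if
    \<open>b^2 \<ge> 2*c^2\<close> then also \<open>a^2 \<ge> 2*c^2\<close>; the middle case
    combines \<open>meet1\<close> and \<open>disj2\<close>.\<close>
  show ?thesis
    using disj1 disj2 meet1 meet2 on off cb ba by auto
qed

end
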